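(* Let $X_{ij}$ be i.i.d. real random variables with finite moments $m_r=\mathbb{E}X_{ij}^r$, $r\le4$. Put $\mu_2=m_2-m_1^2$, $\mu_3=m_3-3m_1m_2+2m_1^3$, $\mu_4=m_4-4m_1m_3+6m_1^2m_2-3m_1^4$, and assume $\mu_2\neq0$. For $n\ge0$ let $A=(X_{ij})_{n\times n}$ and $f_4(n)=\mathbb{E}\,|A|^4$. Then $$f_4(n)=(n!)^2\mu_2^{2n}\sum_{j=0}^n\frac1{j!}\left(\frac{\mu_4}{\mu_2^2}-3\right)^j\sum_{i=-2}^4q_i\binom{n-j+i}{i},$$ where $$\begin{aligned} q_{-2}&=\frac{m_1^4\mu_3^4}{\mu_2^8},\qquad q_{-1}=-\frac{4m_1^3\mu_3^3\left(\mu_2^2+m_1\mu_3\right)}{\mu_2^8},\\ q_0&=\frac{6m_1^2\mu_3^2\left(\mu_2^4+2m_1\mu_2^2\mu_3+m_1^2\mu_3^2-m_1^2\mu_2^3\right)}{\mu_2^8},\\ q_1&=\frac{2m_1\left(6m_1^2\mu_2^5\mu_3-2m_1^3\mu_2^6-2\mu_2^6\mu_3+9m_1^3\mu_2^3\mu_3^2-6m_1\mu_2^4\mu_3^2-6m_1^2\mu_2^2\mu_3^3-2m_1^3\mu_3^4\right)}{\mu_2^8},\\ q_2&=1+\frac{m_1\left(19m_1^3\mu_2^6-6m_1\mu_2^7-24m_1^2\mu_2^5\mu_3+4\mu_2^6\mu_3-18m_1^3\mu_2^3\mu_3^2+6m_1\mu_2^4\mu_3^2+4m_1^2\mu_2^2\mu_3^3+m_1^3\mu_3^4\right)}{\mu_2^8},\\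 q_3&=\frac{3m_1^2\left(2\mu_2^4-9m_1^2\mu_2^3+4m_1\mu_2^2\mu_3+2m_1^2\mu_3^2\right)}{\mu_2^5},\qquad q_4=\frac{12m_1^4}{\mu_2^2}. \end{aligned}$$
   Context: $|A|$ denotes the determinant of $A$; the determinant of the empty matrix is $1$. Binomial coefficients with negative lower index are given by the conventions $\binom{-2}{-2}=\binom{-1}{-1}=1$, $\binom{-1}{-2}=-1$, and $\binom{j}{-2}=\binom{j}{-1}=0$ for $j\ge0$. Also $0^0=1$. *)

theory Defs
  imports "HOL-Probability.Probability" "Jordan_Normal_Form.Determinant"
begin

text \<open>
  Binomial coefficients with integer arguments, extended to the lower indices \<open>-1\<close> and \<open>-2\<close>:
  \<open>binom(-2,-2) = binom(-1,-1) = 1\<close>, \<open>binom(-1,-2) = -1\<close>, and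
  \<open>binom(j,-1) = binom(j,-2) = 0\<close> for \<open>j \<ge> 0\<close>. All remaining argument pairs, which get the
  value \<open>0\<close>, do not occur: \<open>binom(k + i, i)\<close> is only used with \<open>k \<ge> 0\<close> and \<open>-2 \<le> i \<le> 4\<close>.
\<close>

definition ext_binom :: "int \<Rightarrow> int \<Rightarrow> int" where
  "ext_binom a b =
     (if 0 \<le> a \<and> 0 \<le> b then int (nat a choose nat b)
      else if (a, b) = (-2, -2) \<or> (a, b) = (-1, -1) then 1
      else if (a, b) = (-1, -2) then -1
      else 0)"

definition q_coeff :: "real \<Rightarrow> real \<Rightarrow> real \<Rightarrow> int \<Rightarrow> real" where
  "q_coeff m\<^sub>1 \<mu>\<^sub>2 \<mu>\<^sub>3 i =
    (if i = -2 then m\<^sub>1 ^ 4 * \<mu>\<^sub>3 ^ 4 / \<mu>\<^sub>2 ^ 8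
     else if i = -1 then - (4 * m\<^sub>1 ^ 3 * \<mu>\<^sub>3 ^ 3 * (\<mu>\<^sub>2 ^ 2 + m\<^sub>1 * \<mu>\<^sub>3)) / \<mu>\<^sub>2 ^ 8
     else if i = 0 then
       6 * m\<^sub>1 ^ 2 * \<mu>\<^sub>3 ^ 2 *
         (\<mu>\<^sub>2 ^ 4 + 2 * m\<^sub>1 * \<mu>\<^sub>2 ^ 2 * \<mu>\<^sub>3 + m\<^sub>1 ^ 2 * \<mu>\<^sub>3 ^ 2 - m\<^sub>1 ^ 2 * \<mu>\<^sub>2 ^ 3) / \<mu>\<^sub>2 ^ 8
     else if i = 1 then
       2 * m\<^sub>1 *
         (6 * m\<^sub>1 ^ 2 * \<mu>\<^sub>2 ^ 5 * \<mu>\<^sub>3 - 2 * m\<^sub>1 ^ 3 * \<mu>\<^sub>2 ^ 6 - 2 * \<mu>\<^sub>2 ^ 6 * \<mu>\<^sub>3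
          + 9 * m\<^sub>1 ^ 3 * \<mu>\<^sub>2 ^ 3 * \<mu>\<^sub>3 ^ 2 - 6 * m\<^sub>1 * \<mu>\<^sub>2 ^ 4 * \<mu>\<^sub>3 ^ 2
          - 6 * m\<^sub>1 ^ 2 * \<mu>\<^sub>2 ^ 2 * \<mu>\<^sub>3 ^ 3 - 2 * m\<^sub>1 ^ 3 * \<mu>\<^sub>3 ^ 4) / \<mu>\<^sub>2 ^ 8
     else if i = 2 then
       1 + m\<^sub>1 *
         (19 * m\<^sub>1 ^ 3 * \<mu>\<^sub>2 ^ 6 - 6 * m\<^sub>1 * \<mu>\<^sub>2 ^ 7 - 24 * m\<^sub>1 ^ 2 * \<mu>\<^sub>2 ^ 5 * \<mu>\<^sub>3
          + 4 * \<mu>\<^sub>2 ^ 6 * \<mu>\<^sub>3 - 18 * m\<^sub>1 ^ 3 * \<mu>\<^sub>2 ^ 3 * \<mu>\<^sub>3 ^ 2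
          + 6 * m\<^sub>1 * \<mu>\<^sub>2 ^ 4 * \<mu>\<^sub>3 ^ 2 + 4 * m\<^sub>1 ^ 2 * \<mu>\<^sub>2 ^ 2 * \<mu>\<^sub>3 ^ 3
          + m\<^sub>1 ^ 3 * \<mu>\<^sub>3 ^ 4) / \<mu>\<^sub>2 ^ 8
     else if i = 3 then
       3 * m\<^sub>1 ^ 2 *
         (2 * \<mu>\<^sub>2 ^ 4 - 9 * m\<^sub>1 ^ 2 * \<mu>\<^sub>2 ^ 3 + 4 * m\<^sub>1 * \<mu>\<^sub>2 ^ 2 * \<mu>\<^sub>3
          + 2 * m\<^sub>1 ^ 2 * \<mu>\<^sub>3 ^ 2) / \<mu>\<^sub>2 ^ 5
     else if i = 4 then 12 * m\<^sub>1 ^ 4 / \<mu>\<^sub>2 ^ 2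
     else 0)"

end

theory Submission
  imports Defs
begin

text \<open>
  Write \<open>X = Y + a J\<close> with \<open>Y\<close> centred, \<open>a = m\<^sub>1\<close> and \<open>J\<close> the all-ones matrix, and let
  \<open>\<kappa>\<^sub>2 = \<mu>\<^sub>2\<close>, \<open>\<kappa>\<^sub>3 = \<mu>\<^sub>3\<close>, \<open>\<kappa>\<^sub>4 = \<mu>\<^sub>4 - 3 \<mu>\<^sub>2\<^sup>2\<close> be the cumulants of an entry. The fourth power of
  the determinant has degree at most four in each entry, so its expectation depends only on the
  first four moments. It can therefore be computed with any product functional that has these
  moments; the one used here puts signed weights on the five points \<open>-2, \<dots>, 2\<close>. Integrals become
  finite sums, and \<open>\<kappa>\<^sub>3\<close> and \<open>\<kappa>\<^sub>4\<close> become free real parameters: no distribution with prescribed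
  cumulants has to exist.

  Let \<open>F\<^sub>j(n)\<close> be the mean of \<open>det (Y + a J)\<^sup>j det Y\<^sup>4\<^sup>-\<^sup>j\<close>. Differentiating along a line in the
  \<open>(\<kappa>\<^sub>3, \<kappa>\<^sub>4)\<close>-plane singles out one cell of the matrix and extracts the coefficients of \<open>y\<^sup>4\<close> and
  \<open>y\<^sup>3\<close> in the entry \<open>y\<close> of that cell. The first is a product of four cofactors. The second is a
  product of three cofactors and one determinant with that entry removed; averaging the other
  entries in its row and column turns this determinant into one with constant border \<open>a\<close>, which
  equals \<open>a\<close> times the centred minor. Hence
  \<open>F\<^sub>j(n)' = n\<^sup>2 (\<kappa>\<^sub>4' F\<^sub>j(n - 1) + j a \<kappa>\<^sub>3' F\<^sub>j\<^sub>-\<^sub>1(n - 1))\<close> (\<open>mixed_moment_deriv\<close>). The solution is a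
  Taylor expansion, which reduces everything to \<open>\<kappa>\<^sub>3 = \<kappa>\<^sub>4 = 0\<close>
  (\<open>mixed_moment_fourth_cumulant\<close>, \<open>mixed_moment_third_cumulant\<close>).

  There the entries have the moments of a normal variable up to order four. Now
  \<open>det (Y + a J) = D + a S\<close>, where \<open>S\<close> is the sum of all cofactors, so only the means of \<open>D\<^sup>4\<close>,
  \<open>D\<^sup>2 S\<^sup>2\<close> and \<open>S\<^sup>4\<close> are needed. They follow from the expansion along a row, from the invariance of
  the functional under a change of sign of a row, and from the ratio three to one between the
  means of \<open>(\<Sum> y\<^sub>l M\<^sub>l)\<^sup>4\<close> and of \<open>(\<Sum> y\<^sub>l M\<^sub>l)\<^sup>2 (\<Sum> z\<^sub>l M\<^sub>l)\<^sup>2\<close> for two independent rows \<open>y\<close>, \<open>z\<close>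
  (\<open>gauss_mean_two_rows\<close>, \<open>mixed_moment_gauss\<close>).

  What remains is a polynomial identity in the normalised parameters \<open>a \<kappa>\<^sub>3 / \<kappa>\<^sub>2\<^sup>2\<close> and
  \<open>a\<^sup>2 / \<kappa>\<^sub>2\<close> (\<open>gauss_poly_sum\<close>). It holds with all five terms of the expansion in \<open>\<kappa>\<^sub>3\<close>, whereas the
  expansion for an \<open>n \<times> n\<close> matrix stops at order \<open>n\<close>; the binomial coefficients with lower index
  \<open>-1\<close> and \<open>-2\<close> are exactly the correction for \<open>n = 0\<close> and \<open>n = 1\<close>.
\<close>

section \<open>Product functionals on a finite grid\<close>

text \<open>The entries indexed by \<open>A\<close> are averaged against the weights \<open>w\<close> on \<open>N\<close>; those outside \<open>A\<close>
  are read from \<open>Z\<close>. A partial mean is thus again a function of the whole array, and means over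
  disjoint sets compose. The weights may be negative.\<close>

definition grid_mean ::
  "real set \<Rightarrow> (real \<Rightarrow> real) \<Rightarrow> 'c set \<Rightarrow> (('c \<Rightarrow> real) \<Rightarrow> real) \<Rightarrow> ('c \<Rightarrow> real) \<Rightarrow> real" where
  "grid_mean N w A f Z =
     (\<Sum>g\<in>PiE A (\<lambda>_. N). (\<Prod>c\<in>A. w (g c)) * f (override_on Z g A))"

lemma grid_mean_empty [simp]: "grid_mean N w {} f Z = f Z"
  by (simp add: grid_mean_def)

text \<open>The recursion from which most properties follow by induction on the index set.\<close>

lemma grid_mean_insert:
  assumes "finite A" "c \<notin> A"
  shows "grid_mean N w (insert c A) f Z = (\<Sum>s\<in>N. w s * grid_mean N w A f (Z(c := s)))"
proof -
  have ov: "override_on Z (g(c := s)) (insert c A) = override_on (Z(c := s)) g A" for g s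
    using assms by (auto simp: override_on_def fun_eq_iff)
  have pr: "(\<Prod>x\<in>A. w ((g(c := s)) x)) = (\<Prod>x\<in>A. w (g x))" for g s
    using assms by (intro prod.cong) auto
  have "grid_mean N w (insert c A) f Z =
      (\<Sum>(s, g)\<in>N \<times> PiE A (\<lambda>_. N). w s * (\<Prod>x\<in>A. w (g x)) * f (override_on (Z(c := s)) g A))"
    unfolding grid_mean_def PiE_insert_eq
    using assms
    by (subst sum.reindex[OF inj_combinator[OF assms(2)]])
       (auto simp: ov pr mult.assoc intro!: sum.cong simp del: fun_upd_apply, auto)
  also have "\<dots> = (\<Sum>s\<in>N. w s * grid_mean N w A f (Z(c := s)))"
    by (simp add: grid_mean_def sum.cartesian_product [symmetric] sum_distrib_left mult.assoc)
  finally show ?thesis .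
qed

text \<open>The base point \<open>Z\<close> stays in force outside \<open>A\<close>. This is what allows factors that do not
  depend on the averaged entries to be held fixed at \<open>Z\<close>; the averaged entries may be assumed to
  lie in \<open>N\<close>.\<close>

lemma grid_mean_cong:
  assumes "\<And>Z'. (\<And>c. c \<notin> A \<Longrightarrow> Z' c = Z c) \<Longrightarrow> (\<And>c. c \<in> A \<Longrightarrow> Z' c \<in> N) \<Longrightarrow> f Z' = g Z'"
  shows "grid_mean N w A f Z = grid_mean N w A g Z"
  unfolding grid_mean_def
      by (intro sum.cong refl arg_cong2[where f="(*)"] assms) (auto simp: override_on_def)

lemma grid_mean_add:
  "grid_mean N w A (\<lambda>Z. f Z + g Z) Z = grid_mean N w A f Z + grid_mean N w A g Z"
  by (simp add: grid_mean_def distrib_left sum.distrib)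

lemma grid_mean_cmult:
  "grid_mean N w A (\<lambda>Z. r * f Z) Z = r * grid_mean N w A f Z"
  by (simp add: grid_mean_def sum_distrib_left mult_ac)

lemma grid_mean_sum:
  "grid_mean N w A (\<lambda>Z. \<Sum>i\<in>I. f i Z) Z = (\<Sum>i\<in>I. grid_mean N w A (f i) Z)"
  unfolding grid_mean_def by (simp add: sum_distrib_left sum.swap[of _ I])

lemma grid_mean_swap:
  "grid_mean N w A (\<lambda>Z. grid_mean N' w' B (f Z) e) Z =
   grid_mean N' w' B (\<lambda>e. grid_mean N w A (\<lambda>Z. f Z e) Z) e"
  unfolding grid_mean_def
  by (simp add: sum_distrib_left mult_ac) (subst sum.swap, rule refl)

lemma grid_mean_union:
  assumes "finite A" "finite B" "A \<inter> B = {}"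
  shows "grid_mean N w (A \<union> B) f Z = grid_mean N w A (grid_mean N w B f) Z"
  using assms(1,3)
proof (induction A arbitrary: Z rule: finite_induct)
  case (insert c A)
  with assms(2) show ?case
    by (simp add: grid_mean_insert)
qed simp

lemma grid_mean_const:
  assumes "finite A" "(\<Sum>s\<in>N. w s) = 1"
  shows "grid_mean N w A (\<lambda>_. r) Z = r"
  using assms(1)
  by (induction A arbitrary: Z rule: finite_induct)
     (simp_all add: grid_mean_insert flip: sum_distrib_right add: assms(2))

text \<open>Averaging with mean zero weights replaces an entry by \<open>0\<close> in a function that is affine in
  this entry; being affine in each entry separately is enough, because the entries are averaged
  one after the other.\<close>

lemma grid_mean_affine:
  assumes "finite A" and w: "(\<Sum>s\<in>N. w s) = 1" "(\<Sum>s\<in>N. w s * s) = 0"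
    and affine: "\<And>c Z. c \<in> A \<Longrightarrow> \<exists>b. \<forall>s. f (Z(c := s)) = f (Z(c := 0)) + s * b"
  shows "grid_mean N w A f Z = f (override_on Z (\<lambda>_. 0) A)"
  using assms(1) affine
proof (induction A arbitrary: Z rule: finite_induct)
  case (insert c A)
  have ov: "override_on (Z(c := s)) (\<lambda>_. 0) A = (override_on Z (\<lambda>_. 0) A)(c := s)" for s
    using insert.hyps by (auto simp: override_on_def fun_eq_iff)
  have ov0: "override_on Z (\<lambda>_. 0) (insert c A) = (override_on Z (\<lambda>_. 0) A)(c := 0)"
    by (auto simp: override_on_def fun_eq_iff)
  obtain b where b: "\<And>s. f ((override_on Z (\<lambda>_. 0) A)(c := s)) =
      f ((override_on Z (\<lambda>_. 0) A)(c := 0)) + s * b"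
    using insert.prems[of c] by blast
  have "grid_mean N w (insert c A) f Z =
      (\<Sum>s\<in>N. w s * f ((override_on Z (\<lambda>_. 0) A)(c := s)))"
    using insert by (simp add: grid_mean_insert ov)
  also have "\<dots> = (\<Sum>s\<in>N. w s * f ((override_on Z (\<lambda>_. 0) A)(c := 0)) + (w s * s) * b)"
    by (subst b) (simp add: algebra_simps)
  also have "\<dots> = f ((override_on Z (\<lambda>_. 0) A)(c := 0))"
    by (simp add: sum.distrib flip: sum_distrib_right add: w)
  finally show ?case by (simp only: ov0)
qed simp

lemma grid_mean_reindex:
  assumes "finite A" "bij p"
  shows "grid_mean N w A (\<lambda>Z. f (Z \<circ> p)) Z = grid_mean N w (p -` A) f (Z \<circ> p)"
  using assms(1)
proof (induction A arbitrary: Z rule: finite_induct)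
  case (insert c A)
  have eq: "p x = c \<longleftrightarrow> x = Hilbert_Choice.inv p c" for x
    using assms(2) by (metis bij_inv_eq_iff)
  have "p -` insert c A = insert (Hilbert_Choice.inv p c) (p -` A)"
    using eq by auto
  moreover have "Z(c := s) \<circ> p = (Z \<circ> p)(Hilbert_Choice.inv p c := s)" for s
    using eq by (auto simp: fun_eq_iff)
  moreover have "Hilbert_Choice.inv p c \<notin> p -` A" "finite (p -` A)"
    using insert.hyps eq[of "Hilbert_Choice.inv p c"] finite_vimageI[OF _ bij_is_inj[OF assms(2)]]
        by auto
  ultimately show ?case
    by (simp only: grid_mean_insert[OF insert.hyps] grid_mean_insert[of "p -` A"] insert.IH
        not_False_eq_True)
qed simp

lemma grid_mean_upd:
  "c \<notin> A \<Longrightarrow> grid_mean N w A f (Z(c := s)) = grid_mean N w A (\<lambda>Z. f (Z(c := s))) Z"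
  unfolding grid_mean_def
  by (intro sum.cong refl arg_cong2[where f="(*)"] arg_cong[where f=f])
      (auto simp: override_on_def fun_eq_iff)

text \<open>Even weights do not see the signs of the entries.\<close>

lemma grid_mean_scale:
  assumes "finite A" and \<sigma>: "\<And>c. \<sigma> c \<in> {-1, 1 :: real}"
    and w: "\<And>s. w (- s) = w s" and N: "\<And>s. s \<in> N \<Longrightarrow> - s \<in> N"
  shows "grid_mean N w A (\<lambda>Z. f (\<lambda>c. \<sigma> c * Z c)) Z = grid_mean N w A f (\<lambda>c. \<sigma> c * Z c)"
  using assms(1)
proof (induction A arbitrary: Z rule: finite_induct)
  case (insert c A)
  have sq: "\<sigma> c * (\<sigma> c * s) = s" for s using \<sigma>[of c] by auto
  have "(\<Sum>s\<in>N. w s * grid_mean N w A f (\<lambda>x. \<sigma> x * (Z(c := s)) x)) =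
      (\<Sum>s\<in>N. w s * grid_mean N w A f ((\<lambda>x. \<sigma> x * Z x)(c := s)))"
    by (rule sum.reindex_bij_witness[where i="\<lambda>s. \<sigma> c * s" and j="\<lambda>s. \<sigma> c * s"])
       (use \<sigma>[of c] w N in \<open>auto simp: sq fun_eq_iff intro!: arg_cong2[where f="(*)"]
           arg_cong[where f="grid_mean N w A f"]\<close>)
  then show ?case
    using insert by (simp add: grid_mean_insert)
qed simp

lemma grid_mean_prod:
  assumes "finite A" "finite N"
  shows "grid_mean N w A (\<lambda>Z. \<Prod>c\<in>A. \<phi> c (Z c)) Z = (\<Prod>c\<in>A. \<Sum>s\<in>N. w s * \<phi> c s)"
proof -
  have "grid_mean N w A (\<lambda>Z. \<Prod>c\<in>A. \<phi> c (Z c)) Z =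
      (\<Sum>g\<in>PiE A (\<lambda>_. N). \<Prod>c\<in>A. w (g c) * \<phi> c (g c))"
    unfolding grid_mean_def prod.distrib
    by (intro sum.cong refl arg_cong2[where f="(*)"] prod.cong) (simp add: override_on_def)
  also have "\<dots> = (\<Prod>c\<in>A. \<Sum>s\<in>N. w s * \<phi> c s)"
    using assms by (simp add: prod_sum_PiE)
  finally show ?thesis .
qed

text \<open>The product rule: the derivative acts on the weights of one cell at a time.\<close>

lemma grid_mean_deriv:
  assumes "finite A"
    and w: "\<And>s. s \<in> N \<Longrightarrow> ((\<lambda>t. w t s) has_real_derivative w' s) (at t)"
  shows "((\<lambda>t. grid_mean N (w t) A f Z) has_real_derivative
     (\<Sum>c\<in>A. \<Sum>s\<in>N. w' s * grid_mean N (w t) (A - {c}) f (Z(c := s)))) (at t)"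
  using assms(1)
proof (induction A arbitrary: Z rule: finite_induct)
  case (insert c A)
  have diff: "insert c A - {x} = insert c (A - {x})" if "x \<in> A" for x
    using that insert.hyps by auto
  have "((\<lambda>t. \<Sum>s\<in>N. w t s * grid_mean N (w t) A f (Z(c := s))) has_real_derivative
     (\<Sum>s\<in>N. w' s * grid_mean N (w t) A f (Z(c := s)) + w t s *
       (\<Sum>x\<in>A. \<Sum>s'\<in>N. w' s' * grid_mean N (w t) (A - {x}) f (Z(c := s, x := s'))))) (at t)"
    by (intro DERIV_sum DERIV_cong[OF DERIV_mult[OF w insert.IH]])
        (simp_all add: mult.commute del: fun_upd_apply)
  also have "(\<Sum>s\<in>N. w' s * grid_mean N (w t) A f (Z(c := s)) + w t s *
       (\<Sum>x\<in>A. \<Sum>s'\<in>N. w' s' * grid_mean N (w t) (A - {x}) f (Z(c := s, x := s')))) =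
     (\<Sum>s\<in>N. w' s * grid_mean N (w t) A f (Z(c := s))) +
     (\<Sum>x\<in>A. \<Sum>s'\<in>N. w' s' * (\<Sum>s\<in>N. w t s * grid_mean N (w t) (A - {x}) f (Z(c := s, x := s'))))"
  proof -
    have swap: "(\<Sum>s\<in>N. \<Sum>x\<in>A. \<Sum>s'\<in>N. h s x s') = (\<Sum>x\<in>A. \<Sum>s'\<in>N. \<Sum>s\<in>N. h s x s')"
        for h :: "_ \<Rightarrow> _ \<Rightarrow> _ \<Rightarrow> real"
      by (subst sum.swap, rule sum.cong[OF refl], rule sum.swap)
    show ?thesis
      unfolding sum.distrib sum_distrib_left swap by (simp add: mult_ac del: fun_upd_apply)
  qed
  also have "\<dots> = (\<Sum>x\<in>insert c A. \<Sum>s\<in>N. w' s * grid_mean N (w t) (insert c A - {x}) f (Z(x := s)))"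
  proof -
    have "(\<Sum>s\<in>N. w t s * grid_mean N (w t) (A - {x}) f (Z(c := s, x := s'))) =
        grid_mean N (w t) (insert c A - {x}) f (Z(x := s'))" if "x \<in> A" for x s'
    proof -
      have "x \<noteq> c" using that insert.hyps by auto
      then show ?thesis
        using that insert.hyps by (simp add: diff grid_mean_insert fun_upd_twist)
    qed
    then show ?thesis using insert.hyps by simp
  qed
  finally show ?case unfolding grid_mean_insert[OF insert.hyps] .
qed simp

text \<open>Terms with an odd power of an entry vanish. The constant \<open>b\<close> collects the entries already
  split off in the induction. For \<open>q = 3 p\<^sup>2\<close>, the Gaussian value, the last summand disappears.\<close>

lemma grid_mean_linear_form_power4:
  assumes "finite A" and w: "(\<Sum>s\<in>N. w s) = 1" "(\<Sum>s\<in>N. w s * s) = 0"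
     "(\<Sum>s\<in>N. w s * s^2) = p" "(\<Sum>s\<in>N. w s * s^3) = 0" "(\<Sum>s\<in>N. w s * s^4) = q"
  shows "grid_mean N w A (\<lambda>Z. (b + (\<Sum>c\<in>A. Z c * v c)) ^ 4) Z =
    b ^ 4 + 6 * p * b\<^sup>2 * (\<Sum>c\<in>A. (v c)\<^sup>2) + 3 * p\<^sup>2 * (\<Sum>c\<in>A. (v c)\<^sup>2)\<^sup>2 +
    (q - 3 * p\<^sup>2) * (\<Sum>c\<in>A. v c ^ 4)"
  using assms(1)
proof (induction A arbitrary: Z b rule: finite_induct)
  case (insert c A)
  let ?S = "\<Sum>c\<in>A. (v c)\<^sup>2" and ?T = "\<Sum>c\<in>A. v c ^ 4"
  have "grid_mean N w A (\<lambda>Z. (b + (\<Sum>c\<in>insert c A. Z c * v c)) ^ 4) (Z(c := s)) =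
     grid_mean N w A (\<lambda>Z. ((b + s * v c) + (\<Sum>c\<in>A. Z c * v c)) ^ 4) (Z(c := s))" for s
    by (rule grid_mean_cong) (use insert.hyps in \<open>simp add: add.assoc\<close>)
  then have "grid_mean N w (insert c A) (\<lambda>Z. (b + (\<Sum>c\<in>insert c A. Z c * v c)) ^ 4) Z =
     (\<Sum>s\<in>N. w s * ((b + s * v c) ^ 4 + 6 * p * (b + s * v c)\<^sup>2 * ?S + 3 * p\<^sup>2 * ?S\<^sup>2 +
         (q - 3 * p\<^sup>2) * ?T))"
    using insert by (simp add: grid_mean_insert)
  also have "\<dots> = (\<Sum>s\<in>N. w s * (b ^ 4 + 6 * p * b\<^sup>2 * ?S + 3 * p\<^sup>2 * ?S\<^sup>2 + (q - 3 * p\<^sup>2) * ?T)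
      + (w s * s) * (4 * b ^ 3 * v c + 12 * p * b * v c * ?S)
      + (w s * s^2) * (6 * b\<^sup>2 * (v c)\<^sup>2 + 6 * p * (v c)\<^sup>2 * ?S)
      + (w s * s^3) * (4 * b * v c ^ 3) + (w s * s^4) * v c ^ 4)"
    by (rule sum.cong) (simp_all add: algebra_simps power2_eq_square power3_eq_cube power4_eq_xxxx)
  also have "\<dots> = b ^ 4 + 6 * p * b\<^sup>2 * ?S + 3 * p\<^sup>2 * ?S\<^sup>2 + (q - 3 * p\<^sup>2) * ?T
      + p * (6 * b\<^sup>2 * (v c)\<^sup>2 + 6 * p * (v c)\<^sup>2 * ?S) + q * v c ^ 4"
    by (simp add: sum.distrib flip: sum_distrib_right add: w)
  finally show ?case
    using insert.hyps by (simp add: algebra_simps power2_eq_square power4_eq_xxxx)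
qed simp

lemma grid_mean_linear_form_power2:
  assumes "finite A" and w: "(\<Sum>s\<in>N. w s) = 1" "(\<Sum>s\<in>N. w s * s) = 0" "(\<Sum>s\<in>N. w s * s^2) = p"
  shows "grid_mean N w A (\<lambda>Z. (b + (\<Sum>c\<in>A. Z c * v c))\<^sup>2) Z = b\<^sup>2 + p * (\<Sum>c\<in>A. (v c)\<^sup>2)"
  using assms(1)
proof (induction A arbitrary: Z b rule: finite_induct)
  case (insert c A)
  let ?S = "\<Sum>c\<in>A. (v c)\<^sup>2"
  have "grid_mean N w A (\<lambda>Z. (b + (\<Sum>c\<in>insert c A. Z c * v c))\<^sup>2) (Z(c := s)) =
     grid_mean N w A (\<lambda>Z. ((b + s * v c) + (\<Sum>c\<in>A. Z c * v c))\<^sup>2) (Z(c := s))" for s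
    by (rule grid_mean_cong) (use insert.hyps in \<open>simp add: add.assoc\<close>)
  then have "grid_mean N w (insert c A) (\<lambda>Z. (b + (\<Sum>c\<in>insert c A. Z c * v c))\<^sup>2) Z =
     (\<Sum>s\<in>N. w s * ((b + s * v c)\<^sup>2 + p * ?S))"
    using insert by (simp add: grid_mean_insert)
  also have "\<dots> = (\<Sum>s\<in>N. w s * (b\<^sup>2 + p * ?S) + (w s * s) * (2 * b * v c) + (w s * s^2) * (v c)\<^sup>2)"
    by (rule sum.cong) (simp_all add: algebra_simps power2_eq_square)
  also have "\<dots> = b\<^sup>2 + p * ?S + p * (v c)\<^sup>2"
    by (simp add: sum.distrib flip: sum_distrib_right add: w)
  finally show ?case
    using insert.hyps by (simp add: algebra_simps)
qed simp

section \<open>Determinants and cofactors of real arrays\<close>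

definition fdet :: "nat \<Rightarrow> (nat \<times> nat \<Rightarrow> real) \<Rightarrow> real" where
  "fdet n Z = Determinant.det (Matrix.mat n n Z)"

definition fcof :: "nat \<Rightarrow> (nat \<times> nat \<Rightarrow> real) \<Rightarrow> nat \<Rightarrow> nat \<Rightarrow> real" where
  "fcof n Z i j = cofactor (Matrix.mat n n Z) i j"

text \<open>Cofactors and the sum of all cofactors are determinants with a replaced row, which makes
  them accessible to row operations.\<close>

definition set_row :: "(nat \<times> nat \<Rightarrow> real) \<Rightarrow> nat \<Rightarrow> (nat \<Rightarrow> real) \<Rightarrow> nat \<times> nat \<Rightarrow> real" where
  "set_row Z i v = (\<lambda>(p, q). if p = i then v q else Z (p, q))"

lemma fdet_permutes:
  "fdet n Z = (\<Sum>p | p permutes {..<n}. signof p * (\<Prod>i<n. Z (i, p i)))"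
proof -
  have "(\<Prod>i<n. Matrix.mat n n Z $$ (i, p i)) = (\<Prod>i<n. Z (i, p i))"
    if "p permutes {..<n}" for p
    using permutes_in_image[OF that] by (intro prod.cong) auto
  then show ?thesis
    unfolding fdet_def by (subst det_def'[of _ n]) (auto simp: atLeast0LessThan)
qed

lemma fdet_cong:
  assumes "\<And>i j. i < n \<Longrightarrow> j < n \<Longrightarrow> Z (i, j) = Z' (i, j)"
  shows "fdet n Z = fdet n Z'"
  unfolding fdet_def by (rule arg_cong[where f=Determinant.det]) (auto intro!: eq_matI assms)

lemma fcof_cong:
  assumes "i < n" "j < n"
    and "\<And>p q. p < n \<Longrightarrow> q < n \<Longrightarrow> p \<noteq> i \<Longrightarrow> q \<noteq> j \<Longrightarrow> Z (p, q) = Z' (p, q)"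
  shows "fcof n Z i j = fcof n Z' i j"
proof -
  have "mat_delete (Matrix.mat n n Z) i j = mat_delete (Matrix.mat n n Z') i j"
    unfolding mat_delete_def using assms(1,2) by (intro eq_matI) (auto intro!: assms(3))
  then show ?thesis by (simp add: fcof_def cofactor_def)
qed

lemma fdet_expand_row:
  "i < n \<Longrightarrow> fdet n Z = (\<Sum>j<n. Z (i, j) * fcof n Z i j)"
  unfolding fdet_def fcof_def by (subst laplace_expansion_row[of _ n i]) auto

lemma fdet_expand_col:
  "j < n \<Longrightarrow> fdet n Z = (\<Sum>i<n. Z (i, j) * fcof n Z i j)"
  unfolding fdet_def fcof_def by (subst laplace_expansion_column[of _ n j]) auto

lemma fcof_set_row [simp]:
  "i < n \<Longrightarrow> j < n \<Longrightarrow> fcof n (set_row Z i v) i j = fcof n Z i j"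
  by (rule fcof_cong) (auto simp: set_row_def)

lemma fdet_set_row:
  "i < n \<Longrightarrow> fdet n (set_row Z i v) = (\<Sum>j<n. v j * fcof n Z i j)"
  by (subst fdet_expand_row[of i]) (auto simp: set_row_def[of Z i v, THEN fun_cong])

lemma fcof_last: "fcof (Suc n) Z n n = fdet n Z"
proof -
  have "mat_delete (Matrix.mat (Suc n) (Suc n) Z) n n = Matrix.mat n n Z"
    unfolding mat_delete_def by (intro eq_matI) auto
  then show ?thesis by (simp add: fcof_def fdet_def cofactor_def)
qed

lemma fdet_transpose: "fdet n (Z \<circ> prod.swap) = fdet n Z"
proof -
  have "Matrix.mat n n (Z \<circ> prod.swap) = transpose_mat (Matrix.mat n n Z)"
    by (intro eq_matI) auto
  then show ?thesis
    using det_transpose[of "Matrix.mat n n Z" n] by (simp add: fdet_def)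
qed

lemma fcof_transpose:
  assumes "i < n" "j < n"
  shows "fcof n (Z \<circ> prod.swap) i j = fcof n Z j i"
proof -
  have "mat_delete (Matrix.mat n n (Z \<circ> prod.swap)) i j =
      transpose_mat (mat_delete (Matrix.mat n n Z) j i)"
    unfolding mat_delete_def using assms by (intro eq_matI) auto
  then show ?thesis
    using det_transpose[of "mat_delete (Matrix.mat n n Z) j i" "n - 1"]
        mat_delete_carrier[of "Matrix.mat n n Z" n n j i]
    by (simp add: fcof_def cofactor_def add.commute)
qed

lemma fdet_scale_rows:
  "fdet n (\<lambda>c. \<epsilon> (fst c) * Z c) = (\<Prod>i<n. \<epsilon> i) * fdet n Z"
  by (simp add: fdet_permutes prod.distrib sum_distrib_left mult_ac)

lemma fdet_permute_rows:
  assumes "p permutes {..<n}"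
  shows "fdet n (\<lambda>(i, j). Z (p i, j)) = signof p * fdet n Z"
proof -
  have "Matrix.mat n n (\<lambda>(i, j). Z (p i, j)) = Matrix.mat n n (\<lambda>(i, j). Matrix.mat n n Z $$ (p i, j))"
    using permutes_in_image[OF assms] by (intro eq_matI) auto
  then show ?thesis
    using det_permute_rows[of "Matrix.mat n n Z" n p] assms
    by (simp add: fdet_def atLeast0LessThan)
qed

lemma fdet_eq_rows:
  assumes "i < n" "k < n" "i \<noteq> k" "\<And>j. j < n \<Longrightarrow> Z (i, j) = Z (k, j)"
  shows "fdet n Z = 0"
  unfolding fdet_def
  by (rule det_identical_rows[of _ n i k]) (use assms in \<open>auto intro!: eq_vecI\<close>)

lemma fdet_set_row_add:
  assumes "i < n"
  shows "fdet n (set_row Z i (\<lambda>j. u j + t * v j)) = fdet n (set_row Z i u) + t * fdet n (set_row Z i v)"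
  using assms by (simp add: fdet_set_row sum_distrib_left algebra_simps sum.distrib)

lemma set_row_same: "set_row Z i (\<lambda>j. Z (i, j)) = Z"
  by (auto simp: set_row_def fun_eq_iff)

text \<open>The multiples are added to the rows \<open>0, \<dots>, m - 1\<close> successively; each step adds a multiple of
  a determinant with two equal rows.\<close>

lemma fdet_add_row_multiples:
  assumes r: "r < n"
  shows "fdet n (\<lambda>(i, j). if i = r then Z (r, j) else Z (i, j) + t i * Z (r, j)) = fdet n Z"
proof -
  have "fdet n (\<lambda>(i, j). if i \<noteq> r \<and> i < m then Z (i, j) + t i * Z (r, j) else Z (i, j)) = fdet n Z"
    if "m \<le> n" for m
    using that
  proof (induction m)
    case (Suc m)
    let ?Y = "\<lambda>(i, j). if i \<noteq> r \<and> i < m then Z (i, j) + t i * Z (r, j) else Z (i, j)"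
    have *: "(\<lambda>(i, j). if i \<noteq> r \<and> i < Suc m then Z (i, j) + t i * Z (r, j) else Z (i, j)) =
      (if m = r then ?Y else set_row ?Y m (\<lambda>j. ?Y (m, j) + t m * ?Y (r, j)))"
      by (auto simp: set_row_def fun_eq_iff less_Suc_eq)
    show ?case
    proof (cases "m = r")
      case False
      have "fdet n (set_row ?Y m (\<lambda>j. ?Y (r, j))) = 0"
        using False Suc.prems r by (intro fdet_eq_rows[of m n r]) (auto simp: set_row_def)
      then show ?thesis
        unfolding * using False Suc
        by (simp only: if_False fdet_set_row_add[OF Suc_le_lessD[OF Suc.prems]] set_row_same)
    qed (use Suc * in simp)
  qed simp
  from this[of n] show ?thesis
    by (simp add: fdet_cong[of n "\<lambda>(i, j). if i \<noteq> r \<and> i < n then Z (i, j) + t i *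
        Z (r, j) else Z (i, j)"
        "\<lambda>(i, j). if i = r then Z (r, j) else Z (i, j) + t i * Z (r, j)"])
qed

lemma fdet_upd:
  assumes "i < n" "j < n"
  shows "fdet n (Z((i, j) := s)) = fdet n (Z((i, j) := 0)) + s * fcof n Z i j"
proof -
  have c: "fcof n (Z((i, j) := s)) i j' = fcof n Z i j'" if "j' < n" for s j'
    using assms that by (intro fcof_cong) auto
  have "fdet n (Z((i, j) := s)) = s * fcof n Z i j + (\<Sum>j'\<in>{..<n} - {j}. Z (i, j') * fcof n Z i j')"
      for s
    using assms
        by (subst fdet_expand_row[OF assms(1)], subst sum.remove[of _ j])
            (auto simp: c intro!: sum.cong)
  from this[of s] this[of 0] show ?thesis by simp
qed

text \<open>The constant is added to one row after the other. When row \<open>m\<close> receives it, linearity in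
  this row produces a determinant with row \<open>m\<close> constantly \<open>1\<close>, and from it the constants already
  present in the earlier rows can be cleared.\<close>

lemma fdet_add_const:
  "fdet n (\<lambda>c. Z c + a) = fdet n Z + a * (\<Sum>i<n. fdet n (set_row Z i (\<lambda>_. 1)))"
proof -
  have "fdet n (\<lambda>(i, j). if i < m then Z (i, j) + a else Z (i, j)) =
      fdet n Z + a * (\<Sum>i<m. fdet n (set_row Z i (\<lambda>_. 1)))" if "m \<le> n" for m
    using that
  proof (induction m)
    case (Suc m)
    let ?Y = "\<lambda>(i, j). if i < m then Z (i, j) + a else Z (i, j)"
    let ?U = "set_row Z m (\<lambda>_. 1)"
    have *: "(\<lambda>(i, j). if i < Suc m then Z (i, j) + a else Z (i, j)) =
      set_row ?Y m (\<lambda>j. ?Y (m, j) + a * 1)"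
      by (auto simp: set_row_def fun_eq_iff less_Suc_eq)
    have "fdet n (set_row ?Y m (\<lambda>_. 1)) =
        fdet n (\<lambda>(i, j). if i = m then ?U (m, j) else ?U (i, j) + (if i < m then a else 0) * ?U (m, j))"
      by (rule fdet_cong) (auto simp: set_row_def)
    also have "\<dots> = fdet n ?U"
      using Suc.prems by (intro fdet_add_row_multiples) auto
    finally show ?case
      unfolding * using Suc
      by (simp only: fdet_set_row_add[OF Suc_le_lessD[OF Suc.prems]] set_row_same)
          (simp add: algebra_simps)
  qed simp
  from this[of n] show ?thesis
    by (simp add: fdet_cong[of n "\<lambda>(i, j). if i < n then Z (i, j) + a else Z (i, j)" "\<lambda>c. Z c + a"])
qed

text \<open>Subtracting the last row from all others removes the shift \<open>a\<close> from the block and leaves a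
  single nonzero entry in the last column.\<close>

lemma fdet_constant_border:
  assumes "\<And>i j. i < n \<Longrightarrow> j < n \<Longrightarrow> B (i, j) = Z (i, j) + a"
    and "\<And>i. i \<le> n \<Longrightarrow> B (i, n) = a" "\<And>j. j \<le> n \<Longrightarrow> B (n, j) = a"
  shows "fdet (Suc n) B = a * fdet n Z"
proof -
  define Q where "Q = (\<lambda>(i, j). if i = n then a else if j = n then 0 else Z (i, j))"
  have "fdet (Suc n) B = fdet (Suc n) (\<lambda>(i, j). if i = n then Q (n, j) else Q (i, j) + 1 * Q (n, j))"
    by (rule fdet_cong) (auto simp: Q_def assms less_Suc_eq)
  also have "\<dots> = fdet (Suc n) Q"
    by (rule fdet_add_row_multiples) simp
  also have "\<dots> = a * fcof (Suc n) Q n n"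
    by (subst fdet_expand_col[of n]) (auto simp: Q_def)
  also have "fcof (Suc n) Q n n = fdet n Z"
    unfolding fcof_last by (rule fdet_cong) (auto simp: Q_def)
  finally show ?thesis .
qed

section \<open>Dependence on the third and fourth cumulants\<close>

definition grid :: "real set" where "grid = {-2, -1, 0, 1, 2}"

text \<open>The signed weights on \<open>grid\<close>, obtained by Lagrange interpolation, of total mass \<open>1\<close>, mean
  \<open>0\<close> and moments \<open>p\<^sub>2\<close>, \<open>p\<^sub>3\<close>, \<open>p\<^sub>4\<close> of order two to four. They depend affinely on these moments
  and are even for \<open>p\<^sub>3 = 0\<close>.\<close>

definition grid_weight :: "real \<Rightarrow> real \<Rightarrow> real \<Rightarrow> real \<Rightarrow> real" where
  "grid_weight p\<^sub>2 p\<^sub>3 p\<^sub>4 s =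
     (if s = 0 then 1 - 5 / 4 * p\<^sub>2 + p\<^sub>4 / 4
      else if \<bar>s\<bar> = 1 then (4 * p\<^sub>2 - p\<^sub>4) / 6 - s * p\<^sub>3 / 6
      else (p\<^sub>4 - p\<^sub>2) / 24 + s * p\<^sub>3 / 24)"

lemma finite_grid [simp]: "finite grid" by (simp add: grid_def)

lemma grid_weight_quartic:
  "(\<Sum>s\<in>grid. grid_weight p\<^sub>2 p\<^sub>3 p\<^sub>4 s * (A + B * s + C * s\<^sup>2 + D * s ^ 3 + E * s ^ 4)) =
   A + C * p\<^sub>2 + D * p\<^sub>3 + E * p\<^sub>4"
  by (simp add: grid_def grid_weight_def field_simps)

lemma grid_weight_moments:
  "(\<Sum>s\<in>grid. grid_weight p\<^sub>2 p\<^sub>3 p\<^sub>4 s) = 1" "(\<Sum>s\<in>grid. grid_weight p\<^sub>2 p\<^sub>3 p\<^sub>4 s * s) = 0"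
  "(\<Sum>s\<in>grid. grid_weight p\<^sub>2 p\<^sub>3 p\<^sub>4 s * s\<^sup>2) = p\<^sub>2" "(\<Sum>s\<in>grid. grid_weight p\<^sub>2 p\<^sub>3 p\<^sub>4 s * s ^ 3) =
      p\<^sub>3"
  "(\<Sum>s\<in>grid. grid_weight p\<^sub>2 p\<^sub>3 p\<^sub>4 s * s ^ 4) = p\<^sub>4"
  using grid_weight_quartic[of p\<^sub>2 p\<^sub>3 p\<^sub>4 1 0 0 0 0] grid_weight_quartic[of p\<^sub>2 p\<^sub>3 p\<^sub>4 0 1 0 0 0]
    grid_weight_quartic[of p\<^sub>2 p\<^sub>3 p\<^sub>4 0 0 1 0 0] grid_weight_quartic[of p\<^sub>2 p\<^sub>3 p\<^sub>4 0 0 0 1 0]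
    grid_weight_quartic[of p\<^sub>2 p\<^sub>3 p\<^sub>4 0 0 0 0 1] by simp_all

definition cells :: "nat \<Rightarrow> (nat \<times> nat) set" where
  "cells n = {..<n} \<times> {..<n}"

lemma finite_cells [simp]: "finite (cells n)" by (simp add: cells_def)

text \<open>The parameters \<open>\<kappa>\<^sub>2\<close>, \<open>\<kappa>\<^sub>3\<close>, \<open>\<kappa>\<^sub>4\<close> are the cumulants of a centred entry, whose fourth moment
  is therefore \<open>\<kappa>\<^sub>4 + 3 \<kappa>\<^sub>2\<^sup>2\<close>. The exponent \<open>j\<close> counts the factors that carry the shift \<open>a\<close>;
  varying \<open>\<kappa>\<^sub>3\<close> removes the shift from these factors one by one.\<close>

definition mixed_moment :: "real \<Rightarrow> real \<Rightarrow> real \<Rightarrow> real \<Rightarrow> nat \<Rightarrow> nat \<Rightarrow> real" where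
  "mixed_moment \<kappa>\<^sub>2 \<kappa>\<^sub>3 \<kappa>\<^sub>4 a j n =
     grid_mean grid (grid_weight \<kappa>\<^sub>2 \<kappa>\<^sub>3 (\<kappa>\<^sub>4 + 3 * \<kappa>\<^sub>2\<^sup>2)) (cells n)
       (\<lambda>Z. fdet n (\<lambda>c. Z c + a) ^ j * fdet n Z ^ (4 - j)) (\<lambda>_. 0)"

lemma mixed_moment_0: "mixed_moment \<kappa>\<^sub>2 \<kappa>\<^sub>3 \<kappa>\<^sub>4 a j 0 = 1"
  by (simp add: mixed_moment_def cells_def fdet_def)

lemma fdet_permute_cells:
  assumes "p permutes {..<n}" "q permutes {..<n}"
  shows "fdet n (Z \<circ> map_prod p q) = signof p * signof q * fdet n Z"
proof -
  have "fdet n (Z \<circ> map_prod p q) = fdet n (\<lambda>(i, j). (Z \<circ> map_prod id q) (p i, j))"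
    by (rule fdet_cong) simp
  also have "\<dots> = signof p * fdet n (Z \<circ> map_prod id q)"
    by (rule fdet_permute_rows[OF assms(1)])
  also have "fdet n (Z \<circ> map_prod id q) = fdet n ((\<lambda>(i, j). (Z \<circ> prod.swap) (q i, j)) \<circ> prod.swap)"
    by (rule fdet_cong) simp
  also have "\<dots> = signof q * fdet n Z"
    by (simp only: fdet_transpose fdet_permute_rows[OF assms(2)])
  finally show ?thesis by (simp only: mult.assoc)
qed

text \<open>The last row and the last column except for the corner, which is set to \<open>0\<close>, are averaged.
  The determinant is affine in each of these entries, so that they are replaced by \<open>0\<close> and the
  border becomes constant.\<close>

lemma grid_mean_border:
  assumes w: "(\<Sum>s\<in>N. w s) = 1" "(\<Sum>s\<in>N. w s * s) = 0"
  shows "grid_mean N w ({n} \<times> {..<n} \<union> {..<n} \<times> {n})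
     (\<lambda>Z. fdet (Suc n) (\<lambda>c. (Z((n, n) := 0)) c + a)) Z = a * fdet n Z"
    (is "grid_mean N w ?R ?f Z = _")
proof -
  have "\<exists>b. \<forall>s. ?f (Z(c := s)) = ?f (Z(c := 0)) + s * b" if c: "c \<in> ?R" for c Z
  proof -
    obtain i j where ij: "c = (i, j)" "i < Suc n" "j < Suc n" "(i, j) \<noteq> (n, n)" using c by auto
    define Y where "Y = (\<lambda>c. (Z((n, n) := 0)) c + a)"
    have "?f (Z(c := s)) = fdet (Suc n) (Y((i, j) := s + a))" for s
      by (rule arg_cong[where f="fdet (Suc n)"]) (use ij in \<open>auto simp: Y_def fun_eq_iff\<close>)
    then have "?f (Z(c := s)) = fdet (Suc n) (Y((i, j) := 0)) + (s + a) * fcof (Suc n) Y i j" for s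
      by (simp only: fdet_upd[OF ij(2,3), of Y "s + a"])
    then show ?thesis
      by (intro exI[of _ "fcof (Suc n) Y i j"]) (simp add: algebra_simps)
  qed
  then have "grid_mean N w ?R ?f Z = ?f (override_on Z (\<lambda>_. 0) ?R)"
    by (intro grid_mean_affine w) auto
  also have "\<dots> = a * fdet n Z"
    by (rule fdet_constant_border) (auto simp: override_on_def)
  finally show ?thesis .
qed

lemma grid_weight_direction_quartic:
  "(\<Sum>s\<in>grid. (grid_weight 0 d\<^sub>3 d\<^sub>4 s - grid_weight 0 0 0 s) *
      (A + B * s + C * s\<^sup>2 + D * s ^ 3 + E * s ^ 4)) =
   d\<^sub>4 * E + d\<^sub>3 * D"
  by (simp add: left_diff_distrib sum_subtractf grid_weight_quartic)

text \<open>The difference of weights is the derivative of \<open>grid_weight\<close> in the direction \<open>(0, d\<^sub>3,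
  d\<^sub>4)\<close>. It annihilates the powers of order at most two, hence only the coefficients of \<open>s\<^sup>3\<close> and
  \<open>s\<^sup>4\<close> count.\<close>

lemma grid_weight_direction:
  fixes j :: nat
  assumes "j \<le> 4"
  shows "(\<Sum>s\<in>grid. (grid_weight 0 d\<^sub>3 d\<^sub>4 s - grid_weight 0 0 0 s) *
      ((A + s * C) ^ j * (A' + s * C') ^ (4 - j))) =
     d\<^sub>4 * (C ^ j * C' ^ (4 - j)) +
     d\<^sub>3 * (real j * (C ^ (j - 1) * C' ^ (4 - j)) * A + real (4 - j) * (C ^ j * C' ^ (3 - j)) * A')"
    (is "?L = ?R")
proof -
  have "\<exists>c\<^sub>0 c\<^sub>1 c\<^sub>2. \<forall>s. (A + s * C) ^ j * (A' + s * C') ^ (4 - j) = c\<^sub>0 + c\<^sub>1 * s + c\<^sub>2 * s\<^sup>2 +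
      (real j * (C ^ (j - 1) * C' ^ (4 - j)) * A + real (4 - j) * (C ^ j * C' ^ (3 - j)) * A') * s ^ 3 +
      (C ^ j * C' ^ (4 - j)) * s ^ 4"
  proof -
    consider "j = 0" | "j = 1" | "j = 2" | "j = 3" | "j = 4" using assms by linarith
    then show ?thesis
    proof cases
      case 1
      show ?thesis unfolding 1
        by (rule exI[of _ "A' ^ 4"], rule exI[of _ "4 * A' ^ 3 * C'"], rule exI[of _ "6 * A'\<^sup>2 * C'\<^sup>2"])
           (simp add: algebra_simps power2_eq_square power3_eq_cube power4_eq_xxxx)
    next
      case 2
      show ?thesis unfolding 2
        by (rule exI[of _ "A * A' ^ 3"], rule exI[of _ "C * A' ^ 3 + 3 * A * A'\<^sup>2 * C'"],
            rule exI[of _ "3 * C * A'\<^sup>2 * C' + 3 * A * A' * C'\<^sup>2"])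
           (simp add: algebra_simps power2_eq_square power3_eq_cube power4_eq_xxxx)
    next
      case 3
      show ?thesis unfolding 3
        by (rule exI[of _ "A\<^sup>2 * A'\<^sup>2"], rule exI[of _ "2 * A * C * A'\<^sup>2 + 2 * A\<^sup>2 * A' * C'"],
            rule exI[of _ "C\<^sup>2 * A'\<^sup>2 + 4 * A * C * A' * C' + A\<^sup>2 * C'\<^sup>2"])
           (simp add: algebra_simps power2_eq_square power3_eq_cube power4_eq_xxxx)
    next
      case 4
      show ?thesis unfolding 4
        by (rule exI[of _ "A ^ 3 * A'"], rule exI[of _ "A ^ 3 * C' + 3 * A\<^sup>2 * C * A'"],
            rule exI[of _ "3 * A\<^sup>2 * C * C' + 3 * A * C\<^sup>2 * A'"])
           (simp add: algebra_simps power2_eq_square power3_eq_cube power4_eq_xxxx)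
    next
      case 5
      show ?thesis unfolding 5
        by (rule exI[of _ "A ^ 4"], rule exI[of _ "4 * A ^ 3 * C"], rule exI[of _ "6 * A\<^sup>2 * C\<^sup>2"])
           (simp add: algebra_simps power2_eq_square power3_eq_cube power4_eq_xxxx)
    qed
  qed
  then show ?thesis by (auto simp: grid_weight_direction_quartic)
qed

text \<open>By symmetry all cells contribute like the last one. There the determinants are affine
  functions of the entry with slopes the minors of size \<open>n\<close>, and the constant term of one of them
  survives with the coefficient \<open>d\<^sub>3\<close> and is averaged over its border.\<close>

lemma mixed_moment_deriv:
  assumes j: "j \<le> 4"
  shows "((\<lambda>t. mixed_moment \<kappa>\<^sub>2 (\<kappa>\<^sub>3 + t * d\<^sub>3) (\<kappa>\<^sub>4 + t * d\<^sub>4) a j (Suc n)) has_real_derivative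
     (real (Suc n))\<^sup>2 * (d\<^sub>4 * mixed_moment \<kappa>\<^sub>2 (\<kappa>\<^sub>3 + t * d\<^sub>3) (\<kappa>\<^sub>4 + t * d\<^sub>4) a j n +
        real j * a * d\<^sub>3 * mixed_moment \<kappa>\<^sub>2 (\<kappa>\<^sub>3 + t * d\<^sub>3) (\<kappa>\<^sub>4 + t * d\<^sub>4) a (j - 1) n)) (at t)"
proof -
  let ?n = "Suc n"
  let ?f = "\<lambda>n Z. fdet n (\<lambda>c. Z c + a) ^ j * fdet n Z ^ (4 - j)"
  \<comment> \<open>The weights move along a line, with constant velocity \<open>w'\<close>.\<close>
  define w where "w = (\<lambda>t. grid_weight \<kappa>\<^sub>2 (\<kappa>\<^sub>3 + t * d\<^sub>3) (\<kappa>\<^sub>4 + t * d\<^sub>4 + 3 * \<kappa>\<^sub>2\<^sup>2))"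
  define w' where "w' = (\<lambda>s. grid_weight 0 d\<^sub>3 d\<^sub>4 s - grid_weight 0 0 0 s)"
  have w1: "(\<Sum>s\<in>grid. w t s) = 1" "(\<Sum>s\<in>grid. w t s * s) = 0"
      by (simp_all add: w_def grid_weight_moments)
  have "((\<lambda>t. w t s) has_real_derivative w' s) (at t)" if "s \<in> grid" for s
  proof -
    have "(\<lambda>t. w t s) = (\<lambda>t. w 0 s + t * w' s)"
      by (auto simp: w_def w'_def grid_weight_def field_simps)
    then show ?thesis by (auto intro!: derivative_eq_intros)
  qed
  then have "((\<lambda>t. grid_mean grid (w t) (cells ?n) (?f ?n) (\<lambda>_. 0)) has_real_derivative
     (\<Sum>c\<in>cells ?n. \<Sum>s\<in>grid. w' s * grid_mean grid (w t) (cells ?n - {c}) (?f ?n) ((\<lambda>_. 0)(c := s))))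
         (at t)"
    by (intro grid_mean_deriv) auto
  also have
      "(\<Sum>c\<in>cells ?n. \<Sum>s\<in>grid. w' s * grid_mean grid (w t) (cells ?n - {c}) (?f ?n) ((\<lambda>_. 0)(c := s))) =
     (\<Sum>c\<in>cells ?n. \<Sum>s\<in>grid. w' s * grid_mean grid (w t) (cells ?n - {(n, n)}) (?f ?n)
         ((\<lambda>_. 0)((n, n) := s)))"
  proof (intro sum.cong refl)
    fix c :: "nat \<times> nat" and s :: real assume "c \<in> cells ?n"
    then obtain i k where ik: "c = (i, k)" "i < ?n" "k < ?n" by (auto simp: cells_def)
    \<comment> \<open>Exchanging row \<open>i\<close> and column \<open>k\<close> with the last ones moves \<open>c\<close> to the corner; the signs
        disappear because four determinants are multiplied.\<close>
    let ?p = "Transposition.transpose i n" and ?q = "Transposition.transpose k n"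
    let ?\<pi> = "map_prod ?p ?q"
    have perm: "?p permutes {..<?n}" "?q permutes {..<?n}"
      using ik by (auto intro!: permutes_swap_id)
    have bij: "bij ?\<pi>" by (intro bij_betw_byWitness[where f'="?\<pi>"]) auto
    have inv: "?f ?n (Z \<circ> ?\<pi>) = ?f ?n Z" for Z
    proof -
      have sh: "(\<lambda>c. (Z \<circ> ?\<pi>) c + a) = (\<lambda>c. Z c + a) \<circ> ?\<pi>" by auto
      define \<sigma> :: real where "\<sigma> = signof ?p * signof ?q"
      have \<sigma>: "\<sigma> ^ j * \<sigma> ^ (4 - j) = 1"
      proof -
        have "\<sigma> \<in> {1, -1}" by (auto simp: \<sigma>_def sign_def)
        then show ?thesis using j by (auto simp: power_add[symmetric])
      qed
      have "?f ?n (Z \<circ> ?\<pi>) = (\<sigma> ^ j * \<sigma> ^ (4 - j)) * ?f ?n Z"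
        unfolding sh fdet_permute_cells[OF perm] \<sigma>_def[symmetric] by (simp add: power_mult_distrib)
      then show ?thesis by (simp add: \<sigma>)
    qed
    have pre: "?\<pi> -` (cells ?n - {c}) = cells ?n - {(n, n)}"
    proof -
      have "?p x < ?n \<longleftrightarrow> x < ?n" "?q x < ?n \<longleftrightarrow> x < ?n" for x
        using permutes_in_image[OF perm(1), of x] permutes_in_image[OF perm(2), of x] by simp_all
      moreover have "?p x = i \<longleftrightarrow> x = n" "?q x = k \<longleftrightarrow> x = n" for x
        by (auto simp: Transposition.transpose_def)
      ultimately show ?thesis by (auto simp: cells_def ik)
    qed
    have base: "((\<lambda>_. 0)(c := s)) \<circ> ?\<pi> = (\<lambda>_. 0)((n, n) := s)"
      by (auto simp: fun_eq_iff ik Transposition.transpose_def)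
    have "grid_mean grid (w t) (cells ?n - {c}) (?f ?n) ((\<lambda>_. 0)(c := s)) =
        grid_mean grid (w t) (cells ?n - {c}) (\<lambda>Z. ?f ?n (Z \<circ> ?\<pi>)) ((\<lambda>_. 0)(c := s))"
      by (simp only: inv)
    also have "\<dots> = grid_mean grid (w t) (cells ?n - {(n, n)}) (?f ?n) ((\<lambda>_. 0)((n, n) := s))"
      by (subst grid_mean_reindex[OF _ bij]) (simp_all only: pre base finite_Diff finite_cells)
    finally show "w' s * grid_mean grid (w t) (cells ?n - {c}) (?f ?n) ((\<lambda>_. 0)(c := s)) =
      w' s * grid_mean grid (w t) (cells ?n - {(n, n)}) (?f ?n) ((\<lambda>_. 0)((n, n) := s))" by simp
  qed
  also have "\<dots> = (real ?n)\<^sup>2 *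
     (\<Sum>s\<in>grid. w' s * grid_mean grid (w t) (cells ?n - {(n, n)}) (?f ?n) ((\<lambda>_. 0)((n, n) := s)))"
    by (simp only: sum_constant cells_def card_cartesian_product card_lessThan power2_eq_square
        of_nat_mult)
  also have
      "(\<Sum>s\<in>grid. w' s * grid_mean grid (w t) (cells ?n - {(n, n)}) (?f ?n) ((\<lambda>_. 0)((n, n) := s))) =
     grid_mean grid (w t) (cells ?n - {(n, n)}) (\<lambda>Z. \<Sum>s\<in>grid. w' s * ?f ?n (Z((n, n) := s))) (\<lambda>_. 0)"
    by (subst grid_mean_upd) (simp_all add: grid_mean_sum grid_mean_cmult del: fun_upd_apply)
  also have "\<dots> = d\<^sub>4 * grid_mean grid (w t) (cells n) (?f n) (\<lambda>_. 0) + real j * a * d\<^sub>3 *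
     grid_mean grid (w t) (cells n) (\<lambda>Z. fdet n (\<lambda>c. Z c + a) ^ (j - 1) * fdet n Z ^ (4 - (j - 1)))
         (\<lambda>_. 0)"
  proof -
    let ?R = "{n} \<times> {..<n} \<union> {..<n} \<times> {n}"
    let ?A = "\<lambda>a Z. fdet (Suc n) (\<lambda>c. (Z((n, n) := 0)) c + a)"
    let ?C = "\<lambda>Z. fdet n (\<lambda>c. Z c + a)" and ?C' = "\<lambda>Z. fdet n Z"
    have *: "(\<Sum>s\<in>grid. w' s * ?f ?n (Z((n, n) := s))) =
      d\<^sub>4 * (?C Z ^ j * ?C' Z ^ (4 - j)) +
      d\<^sub>3 * (real j * (?C Z ^ (j - 1) * ?C' Z ^ (4 - j)) * ?A a Z + real (4 - j) *
          (?C Z ^ j * ?C' Z ^ (3 - j)) * ?A 0 Z)" for Z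
    proof -
      have e1: "fdet ?n (\<lambda>c. (Z((n, n) := s)) c + a) = ?A a Z + s * ?C Z" for s
      proof -
        have 1: "(\<lambda>c. (Z((n, n) := s)) c + a) = (\<lambda>c. Z c + a)((n, n) := s + a)" for s by auto
        show ?thesis
          unfolding 1 by (subst (1 2) fdet_upd) (simp_all add: fcof_last algebra_simps)
      qed
      have e2: "fdet ?n (Z((n, n) := s)) = ?A 0 Z + s * ?C' Z" for s
        by (subst fdet_upd) (simp_all add: fcof_last fun_upd_def)
      have e: "?f ?n (Z((n, n) := s)) = (?A a Z + s * ?C Z) ^ j * (?A 0 Z + s * ?C' Z) ^ (4 - j)" for s
        by (simp only: e1[of s] e2[of s])
      show ?thesis
        by (simp only: e w'_def grid_weight_direction[OF j])
    qed
    \<comment> \<open>The minors do not involve the border \<open>?R\<close>; without a shift the averaged border is zero, so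
        the term with \<open>?A 0\<close> disappears.\<close>
    have row: "grid_mean grid (w t) ?R (\<lambda>Z. d\<^sub>4 * (?C Z ^ j * ?C' Z ^ (4 - j)) +
      d\<^sub>3 * (real j * (?C Z ^ (j - 1) * ?C' Z ^ (4 - j)) * ?A a Z + real (4 - j) *
          (?C Z ^ j * ?C' Z ^ (3 - j)) * ?A 0 Z)) Z
      = d\<^sub>4 * (?C Z ^ j * ?C' Z ^ (4 - j)) + real j * a * d\<^sub>3 *
          (?C Z ^ (j - 1) * ?C' Z ^ (4 - (j - 1)))" for Z
    proof -
      have C: "?C Z' = ?C Z" "?C' Z' = ?C' Z" if "\<And>c. c \<notin> ?R \<Longrightarrow> Z' c = Z c" for Z'
        by (rule fdet_cong, use that in simp)+
      have "grid_mean grid (w t) ?R (\<lambda>Z. d\<^sub>4 * (?C Z ^ j * ?C' Z ^ (4 - j)) +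
      d\<^sub>3 * (real j * (?C Z ^ (j - 1) * ?C' Z ^ (4 - j)) * ?A a Z + real (4 - j) *
          (?C Z ^ j * ?C' Z ^ (3 - j)) * ?A 0 Z)) Z =
       grid_mean grid (w t) ?R (\<lambda>Z'. d\<^sub>4 * (?C Z ^ j * ?C' Z ^ (4 - j)) +
      (d\<^sub>3 * (real j * (?C Z ^ (j - 1) * ?C' Z ^ (4 - j))) * ?A a Z' + d\<^sub>3 *
          (real (4 - j) * (?C Z ^ j * ?C' Z ^ (3 - j))) * ?A 0 Z')) Z"
        apply (rule grid_mean_cong)
        subgoal premises p for Z'
        proof -
          have C': "?C Z' = ?C Z" "?C' Z' = ?C' Z" by (rule C, erule p(1))+
          show ?thesis by (simp only: C' distrib_left mult.assoc)
        qed
        done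
      also have "\<dots> =
          d\<^sub>4 * (?C Z ^ j * ?C' Z ^ (4 - j)) + d\<^sub>3 * (real j * (?C Z ^ (j - 1) * ?C' Z ^ (4 - j))) *
              (a * fdet n Z)"
        by (simp only: grid_mean_add grid_mean_cmult grid_mean_border[OF w1] grid_mean_const[OF _ w1(1)]
            finite_Un finite_SigmaI finite_lessThan finite.intros)
      also have "\<dots> = d\<^sub>4 * (?C Z ^ j * ?C' Z ^ (4 - j)) + real j * a * d\<^sub>3 *
          (?C Z ^ (j - 1) * ?C' Z ^ (4 - (j - 1)))"
      proof (cases j)
        case (Suc i)
        then have "4 - (j - 1) = Suc (4 - j)" using j by simp
        then show ?thesis by simp
      qed simp
      finally show ?thesis .
    qed
    have cells: "cells ?n - {(n, n)} = cells n \<union> ?R" "cells n \<inter> ?R = {}"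
      by (auto simp: cells_def less_Suc_eq)
    have "grid_mean grid (w t) (cells n \<union> ?R) (\<lambda>Z. \<Sum>s\<in>grid. w' s * ?f ?n (Z((n, n) := s))) (\<lambda>_. 0) =
      grid_mean grid (w t) (cells n)
          (grid_mean grid (w t) ?R (\<lambda>Z. \<Sum>s\<in>grid. w' s * ?f ?n (Z((n, n) := s)))) (\<lambda>_. 0)"
      by (rule grid_mean_union) (simp_all add: cells(2))
    also have "grid_mean grid (w t) ?R (\<lambda>Z. \<Sum>s\<in>grid. w' s * ?f ?n (Z((n, n) := s))) =
      (\<lambda>Z. d\<^sub>4 * (?C Z ^ j * ?C' Z ^ (4 - j)) + real j * a * d\<^sub>3 *
          (?C Z ^ (j - 1) * ?C' Z ^ (4 - (j - 1))))"
      by (rule ext) (simp only: * row)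
    also have "grid_mean grid (w t) (cells n) \<dots> (\<lambda>_. 0) =
        d\<^sub>4 * grid_mean grid (w t) (cells n) (?f n) (\<lambda>_. 0) + real j * a * d\<^sub>3 *
     grid_mean grid (w t) (cells n) (\<lambda>Z. fdet n (\<lambda>c. Z c + a) ^ (j - 1) * fdet n Z ^ (4 - (j - 1)))
         (\<lambda>_. 0)"
      by (simp only: grid_mean_add grid_mean_cmult)
    finally show ?thesis unfolding cells(1) .
  qed
  finally show ?thesis by (simp add: mixed_moment_def w_def)
qed

section \<open>Gaussian moments: integrating rows and flipping signs\<close>

text \<open>The functional at \<open>\<kappa>\<^sub>3 = \<kappa>\<^sub>4 = 0\<close>: up to order four it has the moments of independent
  centred normal entries of variance \<open>\<kappa>\<close>.\<close>

abbreviation gauss_mean :: "real \<Rightarrow> nat \<Rightarrow> ((nat \<times> nat \<Rightarrow> real) \<Rightarrow> real) \<Rightarrow> real" where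
  "gauss_mean \<kappa> n f \<equiv> grid_mean grid (grid_weight \<kappa> 0 (3 * \<kappa>\<^sup>2)) (cells n) f (\<lambda>_. 0)"

lemma sum_single_row: "(\<Sum>c\<in>{i} \<times> A. h c) = (\<Sum>l\<in>A. h (i, l))"
proof -
  have "{i} \<times> A = Pair i ` A" by auto
  then show ?thesis by (simp add: sum.reindex inj_on_def)
qed

lemma gauss_mean_integrate_row:
  assumes i: "i < n"
    and eq: "\<And>Z. grid_mean grid (grid_weight \<kappa> 0 (3 * \<kappa>\<^sup>2)) ({i} \<times> {..<n}) f Z = g Z"
    and indep: "\<And>Z Z'. (\<And>p q. p \<noteq> i \<Longrightarrow> Z' (p, q) = Z (p, q)) \<Longrightarrow> g Z' = g Z"
  shows "gauss_mean \<kappa> n f = gauss_mean \<kappa> n g"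
proof -
  have cells: "cells n = (cells n - {i} \<times> {..<n}) \<union> {i} \<times> {..<n}"
    using i by (auto simp: cells_def)
  have "grid_mean grid (grid_weight \<kappa> 0 (3 * \<kappa>\<^sup>2)) ({i} \<times> {..<n}) g Z =
      grid_mean grid (grid_weight \<kappa> 0 (3 * \<kappa>\<^sup>2)) ({i} \<times> {..<n}) (\<lambda>_. g Z) Z" for Z
    by (rule grid_mean_cong, rule indep) auto
  then have g: "grid_mean grid (grid_weight \<kappa> 0 (3 * \<kappa>\<^sup>2)) ({i} \<times> {..<n}) g = g"
    by (auto simp: fun_eq_iff grid_mean_const grid_weight_moments)
  have f: "grid_mean grid (grid_weight \<kappa> 0 (3 * \<kappa>\<^sup>2)) ({i} \<times> {..<n}) f = g"
    using eq by auto
  show ?thesis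
    by (subst (1 2) cells, subst (1 2) grid_mean_union) (auto simp: f g)
qed

lemma gauss_mean_row_power4:
  assumes i: "i < n"
    and M: "\<And>l Z Z'. l < n \<Longrightarrow> (\<And>p q. p \<noteq> i \<Longrightarrow> Z' (p, q) = Z (p, q)) \<Longrightarrow> M l Z' = M l Z"
  shows "gauss_mean \<kappa> n (\<lambda>Z. (\<Sum>l<n. Z (i, l) * M l Z) ^ 4) =
      3 * \<kappa>\<^sup>2 * gauss_mean \<kappa> n (\<lambda>Z. (\<Sum>l<n. (M l Z)\<^sup>2)\<^sup>2)"
proof -
  have "grid_mean grid (grid_weight \<kappa> 0 (3 * \<kappa>\<^sup>2)) ({i} \<times> {..<n}) (\<lambda>Z. (\<Sum>l<n. Z (i, l) * M l Z) ^ 4) Z =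
      grid_mean grid (grid_weight \<kappa> 0 (3 * \<kappa>\<^sup>2)) ({i} \<times> {..<n})
          (\<lambda>Z'. (0 + (\<Sum>c\<in>{i} \<times> {..<n}. Z' c * M (snd c) Z)) ^ 4) Z" for Z
    by (rule grid_mean_cong, simp add: sum_single_row, intro arg_cong[where f="\<lambda>x. x ^ 4"] sum.cong refl
        arg_cong2[where f="(*)"] M) auto
  also have "\<dots> Z = 3 * \<kappa>\<^sup>2 * (\<Sum>l<n. (M l Z)\<^sup>2)\<^sup>2" for Z
    by (subst grid_mean_linear_form_power4) (auto simp: grid_weight_moments sum_single_row)
  finally have "gauss_mean \<kappa> n (\<lambda>Z. (\<Sum>l<n. Z (i, l) * M l Z) ^ 4) =
      gauss_mean \<kappa> n (\<lambda>Z. 3 * \<kappa>\<^sup>2 * (\<Sum>l<n. (M l Z)\<^sup>2)\<^sup>2)"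
  proof (rule gauss_mean_integrate_row[OF i])
    fix Z Z' :: "nat \<times> nat \<Rightarrow> real" assume *: "\<And>p q. p \<noteq> i \<Longrightarrow> Z' (p, q) = Z (p, q)"
    show "3 * \<kappa>\<^sup>2 * (\<Sum>l<n. (M l Z')\<^sup>2)\<^sup>2 = 3 * \<kappa>\<^sup>2 * (\<Sum>l<n. (M l Z)\<^sup>2)\<^sup>2"
      using M[where Z'=Z' and Z=Z, OF _ *] by simp
  qed
  then show ?thesis by (simp add: grid_mean_cmult)
qed

lemma gauss_mean_row_power2:
  assumes i: "i < n"
    and M: "\<And>l Z Z'. l < n \<Longrightarrow> (\<And>p q. p \<noteq> i \<Longrightarrow> Z' (p, q) = Z (p, q)) \<Longrightarrow> M l Z' = M l Z"
    and G: "\<And>Z Z'. (\<And>p q. p \<noteq> i \<Longrightarrow> Z' (p, q) = Z (p, q)) \<Longrightarrow> G Z' = G Z"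
  shows "gauss_mean \<kappa> n (\<lambda>Z. (\<Sum>l<n. Z (i, l) * M l Z)\<^sup>2 * G Z) =
      \<kappa> * gauss_mean \<kappa> n (\<lambda>Z. (\<Sum>l<n. (M l Z)\<^sup>2) * G Z)"
proof -
  have MZ: "(\<Sum>l<n. Z'(i, l) * M l Z') = (\<Sum>l<n. Z'(i, l) * M l Z)" "G Z' = G Z"
    if "\<And>c. c \<notin> {i} \<times> {..<n} \<Longrightarrow> Z' c = Z c" for Z Z'
  proof -
    have *: "Z' (p, q) = Z (p, q)" if "p \<noteq> i" for p q
      using \<open>\<And>c. c \<notin> {i} \<times> {..<n} \<Longrightarrow> Z' c = Z c\<close> that by simp
    show "(\<Sum>l<n. Z'(i, l) * M l Z') = (\<Sum>l<n. Z'(i, l) * M l Z)" "G Z' = G Z"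
      using M[where Z'=Z' and Z=Z, OF _ *] G[where Z'=Z' and Z=Z, OF *] by simp_all
  qed
  have "grid_mean grid (grid_weight \<kappa> 0 (3 * \<kappa>\<^sup>2)) ({i} \<times> {..<n}) (\<lambda>Z. (\<Sum>l<n. Z (i, l) * M l Z)\<^sup>2 *
      G Z) Z =
      grid_mean grid (grid_weight \<kappa> 0 (3 * \<kappa>\<^sup>2)) ({i} \<times> {..<n})
          (\<lambda>Z'. G Z * (0 + (\<Sum>c\<in>{i} \<times> {..<n}. Z' c * M (snd c) Z))\<^sup>2) Z" for Z
    apply (rule grid_mean_cong)
    subgoal premises p for Z'
    proof -
      have MZ': "(\<Sum>l<n. Z'(i, l) * M l Z') = (\<Sum>l<n. Z'(i, l) * M l Z)" "G Z' = G Z"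
        by (rule MZ, erule p(1))+
      show ?thesis by (simp add: MZ' sum_single_row)
    qed
    done
  also have "\<dots> Z = \<kappa> * ((\<Sum>l<n. (M l Z)\<^sup>2) * G Z)" for Z
    by (simp only: grid_mean_cmult, subst grid_mean_linear_form_power2)
        (auto simp: grid_weight_moments sum_single_row)
  finally have "gauss_mean \<kappa> n (\<lambda>Z. (\<Sum>l<n. Z (i, l) * M l Z)\<^sup>2 * G Z) =
      gauss_mean \<kappa> n (\<lambda>Z. \<kappa> * ((\<Sum>l<n. (M l Z)\<^sup>2) * G Z))"
  proof (rule gauss_mean_integrate_row[OF i])
    fix Z Z' :: "nat \<times> nat \<Rightarrow> real" assume *: "\<And>p q. p \<noteq> i \<Longrightarrow> Z' (p, q) = Z (p, q)"
    show "\<kappa> * ((\<Sum>l<n. (M l Z')\<^sup>2) * G Z') = \<kappa> * ((\<Sum>l<n. (M l Z)\<^sup>2) * G Z)"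
      using M[where Z'=Z' and Z=Z, OF _ *] G[where Z'=Z' and Z=Z, OF *] by simp
  qed
  then show ?thesis by (simp add: grid_mean_cmult)
qed

lemma gauss_mean_transpose:
  "gauss_mean \<kappa> n (\<lambda>Z. f (Z \<circ> prod.swap)) = gauss_mean \<kappa> n f"
proof -
  have "prod.swap -` cells n = cells n" by (auto simp: cells_def)
  then show ?thesis
    using grid_mean_reindex[of "cells n" prod.swap grid "grid_weight \<kappa> 0 (3 * \<kappa>\<^sup>2)" f "\<lambda>_. 0"]
    by (simp add: comp_def)
qed

lemma gauss_mean_swap_rows:
  assumes "i < n" "k < n"
  shows "gauss_mean \<kappa> n (\<lambda>Z. f (Z \<circ> map_prod (Transposition.transpose i k) id)) = gauss_mean \<kappa> n f"
proof -
  have p: "Transposition.transpose i k permutes {..<n}"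
    using assms by (auto intro!: permutes_swap_id)
  have "map_prod (Transposition.transpose i k) id -` cells n = cells n"
  proof -
    have "Transposition.transpose i k x < n \<longleftrightarrow> x < n" for x
      using permutes_in_image[OF p, of x] by simp
    then show ?thesis by (simp add: cells_def set_eq_iff)
  qed
  moreover have "bij (map_prod (Transposition.transpose i k) (id :: nat \<Rightarrow> nat))"
    by (intro bij_betw_byWitness[where f'="map_prod (Transposition.transpose i k) id"]) auto
  ultimately show ?thesis
    using grid_mean_reindex[of "cells n" "map_prod (Transposition.transpose i k) id" grid
        "grid_weight \<kappa> 0 (3 * \<kappa>\<^sup>2)" f "\<lambda>_. 0"]
    by (simp add: comp_def)
qed

text \<open>For \<open>v\<close> constantly \<open>1\<close> these are the row sums of cofactors, for a unit vector \<open>v\<close> single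
  cofactors.\<close>

definition row_sub :: "nat \<Rightarrow> (nat \<Rightarrow> real) \<Rightarrow> nat \<Rightarrow> (nat \<times> nat \<Rightarrow> real) \<Rightarrow> real" where
  "row_sub n v i Z = fdet n (set_row Z i v)"

lemma row_sub_cong:
  assumes "\<And>p q. p \<noteq> i \<Longrightarrow> Z' (p, q) = Z (p, q)"
  shows "row_sub n v i Z' = row_sub n v i Z"
  unfolding row_sub_def by (rule fdet_cong) (use assms in \<open>auto simp: set_row_def\<close>)

lemma fdet_swap_rows:
  assumes "i < n" "k < n" "i \<noteq> k"
  shows "fdet n (Z \<circ> map_prod (Transposition.transpose i k) id) = - fdet n Z"
  using fdet_permute_cells[of "Transposition.transpose i k" n id Z] assms
  by (simp add: permutes_swap_id permutes_id sign_swap_id)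

lemma row_sub_swap_rows:
  assumes "i < n" "k < n" "i \<noteq> k"
  shows "row_sub n v i (Z \<circ> map_prod (Transposition.transpose i k) id) = - row_sub n v k Z"
proof -
  have "set_row (Z \<circ> map_prod (Transposition.transpose i k) id) i v =
      set_row Z k v \<circ> map_prod (Transposition.transpose i k) id"
    using assms(3) by (auto simp: set_row_def fun_eq_iff Transposition.transpose_def)
  then show ?thesis
    unfolding row_sub_def using fdet_swap_rows[OF assms] by simp
qed

text \<open>Exchanging the rows \<open>i\<close> and \<open>k\<close> maps the two pairs onto each other up to a common sign.\<close>

lemma gauss_mean_row_sub_eq:
  assumes "i < n" "k < n" and h: "\<And>x y. h (- x) (- y) = h x y"
  shows "gauss_mean \<kappa> n (\<lambda>Z. h (fdet n Z) (row_sub n v i Z)) =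
      gauss_mean \<kappa> n (\<lambda>Z. h (fdet n Z) (row_sub n v k Z))"
proof (cases "i = k")
  case False
  have "gauss_mean \<kappa> n (\<lambda>Z. h (fdet n Z) (row_sub n v i Z)) =
      gauss_mean \<kappa> n (\<lambda>Z. h (fdet n (Z \<circ> map_prod (Transposition.transpose i k) id))
         (row_sub n v i (Z \<circ> map_prod (Transposition.transpose i k) id)))"
    by (rule gauss_mean_swap_rows[OF assms(1,2), symmetric])
  then show ?thesis
    by (simp only: fdet_swap_rows[OF assms(1,2) False] row_sub_swap_rows[OF assms(1,2) False] h)
qed simp

text \<open>Replacing row \<open>i\<close> leaves a linear form in row \<open>k\<close>, and replacing row \<open>k\<close> leaves the negative
  of the same linear form in row \<open>i\<close>, with coefficients \<open>M\<^sub>l\<close> that involve neither row.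
  Integrating row \<open>k\<close> on the left and both rows on the right leaves the means of \<open>3 \<kappa>\<^sup>2 (\<Sum>
  M\<^sub>l\<^sup>2)\<^sup>2\<close> and of \<open>\<kappa>\<^sup>2 (\<Sum> M\<^sub>l\<^sup>2)\<^sup>2\<close>.\<close>

lemma gauss_mean_two_rows:
  assumes ik: "i < n" "k < n" "i \<noteq> k"
  shows "gauss_mean \<kappa> n (\<lambda>Z. row_sub n v i Z ^ 4) =
      3 * gauss_mean \<kappa> n (\<lambda>Z. (row_sub n v i Z)\<^sup>2 * (row_sub n v k Z)\<^sup>2)"
proof -
  define M where "M = (\<lambda>l Z. fcof n (set_row Z i v) k l)"
  have Mi: "M l Z' = M l Z" if "l < n" "\<And>p q. p \<noteq> i \<Longrightarrow> Z' (p, q) = Z (p, q)" for l Z Z'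
    unfolding M_def using that ik by (intro fcof_cong) (auto simp: set_row_def)
  have Mk: "M l Z' = M l Z" if "l < n" "\<And>p q. p \<noteq> k \<Longrightarrow> Z' (p, q) = Z (p, q)" for l Z Z'
    unfolding M_def using that ik by (intro fcof_cong) (auto simp: set_row_def)
  have i: "row_sub n v i Z = (\<Sum>l<n. Z (k, l) * M l Z)" for Z
    unfolding row_sub_def M_def by (subst fdet_expand_row[OF ik(2)]) (use ik in \<open>simp add: set_row_def\<close>)
  have k: "row_sub n v k Z = - (\<Sum>l<n. Z (i, l) * M l Z)" for Z
  proof -
    have "row_sub n v k Z = - row_sub n v i (Z \<circ> map_prod (Transposition.transpose i k) id)"
      using row_sub_swap_rows[OF ik] by simp
    also have "\<dots> = - (\<Sum>l<n. Z (i, l) * M l (Z \<circ> map_prod (Transposition.transpose i k) id))"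
      unfolding i by simp
    also have "(\<Sum>l<n. Z (i, l) * M l (Z \<circ> map_prod (Transposition.transpose i k) id)) =
        (\<Sum>l<n. Z (i, l) * M l Z)"
      unfolding M_def using ik
          by (intro sum.cong refl arg_cong2[where f="(*)"] fcof_cong)
              (auto simp: set_row_def Transposition.transpose_def)
    finally show ?thesis .
  qed
  have "gauss_mean \<kappa> n (\<lambda>Z. row_sub n v i Z ^ 4) = 3 * \<kappa>\<^sup>2 * gauss_mean \<kappa> n (\<lambda>Z. (\<Sum>l<n. (M l Z)\<^sup>2)\<^sup>2)"
    unfolding i by (rule gauss_mean_row_power4[OF ik(2) Mk])
  moreover have "gauss_mean \<kappa> n (\<lambda>Z. (row_sub n v i Z)\<^sup>2 * (row_sub n v k Z)\<^sup>2) =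
      \<kappa>\<^sup>2 * gauss_mean \<kappa> n (\<lambda>Z. (\<Sum>l<n. (M l Z)\<^sup>2)\<^sup>2)"
  proof -
    have "gauss_mean \<kappa> n (\<lambda>Z. (row_sub n v i Z)\<^sup>2 * (row_sub n v k Z)\<^sup>2) =
        gauss_mean \<kappa> n (\<lambda>Z. (\<Sum>l<n. Z (k, l) * M l Z)\<^sup>2 * (row_sub n v k Z)\<^sup>2)"
      unfolding i ..
    also have "\<dots> = \<kappa> * gauss_mean \<kappa> n (\<lambda>Z. (\<Sum>l<n. (M l Z)\<^sup>2) * (row_sub n v k Z)\<^sup>2)"
    proof (rule gauss_mean_row_power2[OF ik(2) Mk])
      fix Z Z' :: "nat \<times> nat \<Rightarrow> real" assume *: "\<And>p q. p \<noteq> k \<Longrightarrow> Z' (p, q) = Z (p, q)"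
      show "(row_sub n v k Z')\<^sup>2 = (row_sub n v k Z)\<^sup>2"
        by (rule arg_cong[where f="\<lambda>x. x\<^sup>2"], rule row_sub_cong, erule *)
    qed
    also have "gauss_mean \<kappa> n (\<lambda>Z. (\<Sum>l<n. (M l Z)\<^sup>2) * (row_sub n v k Z)\<^sup>2) =
        gauss_mean \<kappa> n (\<lambda>Z. (\<Sum>l<n. Z (i, l) * M l Z)\<^sup>2 * (\<Sum>l<n. (M l Z)\<^sup>2))"
      by (simp only: k power2_minus mult.commute)
    also have "\<dots> = \<kappa> * gauss_mean \<kappa> n (\<lambda>Z. (\<Sum>l<n. (M l Z)\<^sup>2) * (\<Sum>l<n. (M l Z)\<^sup>2))"
    proof (rule gauss_mean_row_power2[OF ik(1) Mi])
      fix Z Z' :: "nat \<times> nat \<Rightarrow> real" assume *: "\<And>p q. p \<noteq> i \<Longrightarrow> Z' (p, q) = Z (p, q)"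
      show "(\<Sum>l<n. (M l Z')\<^sup>2) = (\<Sum>l<n. (M l Z)\<^sup>2)"
        using Mi[where Z'=Z' and Z=Z, OF _ *] by simp
    qed
    finally show ?thesis by (simp add: power2_eq_square)
  qed
  ultimately show ?thesis by simp
qed

text \<open>The sign of the replaced row drops out, which amounts to multiplying once more by \<open>\<epsilon> i\<close>.\<close>

lemma row_sub_row_signs:
  assumes \<epsilon>: "\<And>i. \<epsilon> i \<in> {-1, 1 :: real}" and i: "i < n"
  shows "row_sub n v i (\<lambda>c. \<epsilon> (fst c) * Z c) = (\<Prod>i<n. \<epsilon> i) * (\<epsilon> i * row_sub n v i Z)"
proof -
  have "row_sub n v i (\<lambda>c. \<epsilon> (fst c) * Z c) = fdet n (\<lambda>c. (\<epsilon>(i := 1)) (fst c) * set_row Z i v c)"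
    unfolding row_sub_def by (rule fdet_cong) (auto simp: set_row_def)
  also have "\<dots> = (\<Prod>p<n. (\<epsilon>(i := 1)) p) * row_sub n v i Z"
    by (simp only: fdet_scale_rows row_sub_def)
  also have "(\<Prod>p<n. (\<epsilon>(i := 1)) p) = (\<Prod>p\<in>{..<n} - {i}. \<epsilon> p)"
    using i by (subst prod.remove[of _ i]) (auto intro!: prod.cong)
  also have "\<dots> = (\<Prod>p<n. \<epsilon> p) * \<epsilon> i"
    using i \<epsilon>[of i] by (subst (2) prod.remove[of _ i]) auto
  finally show ?thesis by simp
qed

lemma gauss_mean_row_signs:
  assumes \<epsilon>: "\<And>i. \<epsilon> i \<in> {-1, 1 :: real}"
  shows "gauss_mean \<kappa> n (\<lambda>Z. f (\<lambda>c. \<epsilon> (fst c) * Z c)) = gauss_mean \<kappa> n f"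
proof -
  have "grid_weight \<kappa> 0 (3 * \<kappa>\<^sup>2) (- s) = grid_weight \<kappa> 0 (3 * \<kappa>\<^sup>2) s" for s
      by (simp add: grid_weight_def)
  moreover have "- s \<in> grid" if "s \<in> grid" for s using that by (auto simp: grid_def)
  ultimately show ?thesis
    using grid_mean_scale[of "cells n" "\<lambda>c. \<epsilon> (fst c)" "grid_weight \<kappa> 0 (3 * \<kappa>\<^sup>2)" grid f "\<lambda>_. 0"] \<epsilon>
    by simp
qed

text \<open>The mean does not change if the rows are multiplied by signs, hence neither if these signs
  are averaged. This removes all terms in which some row sign occurs to an odd power without
  expanding multiple sums.\<close>

lemma gauss_mean_average_signs:
  assumes f: "\<And>\<epsilon> Z. (\<And>i. \<epsilon> i \<in> {-1, 1 :: real}) \<Longrightarrow> f (\<lambda>c. \<epsilon> (fst c) * Z c) = g \<epsilon> Z"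
    and avg: "\<And>Z. grid_mean {-1, 1} (\<lambda>_. 1 / 2) {..<n} (\<lambda>\<epsilon>. g \<epsilon> Z) (\<lambda>_. 1) = h Z"
  shows "gauss_mean \<kappa> n f = gauss_mean \<kappa> n h"
proof -
  have "gauss_mean \<kappa> n f = grid_mean {-1, 1} (\<lambda>_. 1 / 2) {..<n} (\<lambda>\<epsilon>. gauss_mean \<kappa> n f) (\<lambda>_. 1)"
    by (simp add: grid_mean_const)
  also have "\<dots> = grid_mean {-1, 1} (\<lambda>_. 1 / 2) {..<n} (\<lambda>\<epsilon>. gauss_mean \<kappa> n (g \<epsilon>)) (\<lambda>_. 1)"
  proof (rule grid_mean_cong)
    fix \<epsilon> :: "nat \<Rightarrow> real" assume *: "\<And>i. i \<notin> {..<n} \<Longrightarrow> \<epsilon> i = 1" "\<And>i. i \<in> {..<n} \<Longrightarrow> \<epsilon> i \<in> {-1, 1}"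
    have \<epsilon>: "\<epsilon> i \<in> {-1, 1}" for i using *[of i] by (cases "i < n") auto
    show "gauss_mean \<kappa> n f = gauss_mean \<kappa> n (g \<epsilon>)"
      using gauss_mean_row_signs[of \<epsilon> \<kappa> n f, OF \<epsilon>] by (simp only: f[of \<epsilon>, OF \<epsilon>])
  qed
  also have "\<dots> = gauss_mean \<kappa> n (\<lambda>Z. grid_mean {-1, 1} (\<lambda>_. 1 / 2) {..<n} (\<lambda>\<epsilon>. g \<epsilon> Z) (\<lambda>_. 1))"
    by (rule grid_mean_swap)
  finally show ?thesis by (simp only: avg)
qed

lemma prod_signs_power:
  assumes "\<And>i. \<epsilon> i \<in> {-1, 1 :: real}"
  shows "(\<Prod>i<n. \<epsilon> i)\<^sup>2 = 1" "(\<Prod>i<n. \<epsilon> i) ^ 4 = 1"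
proof -
  show *: "(\<Prod>i<n. \<epsilon> i)\<^sup>2 = 1"
    unfolding prod_power_distrib by (rule prod.neutral) (use assms in \<open>auto simp: power2_eq_1_iff\<close>)
  have "(\<Prod>i<n. \<epsilon> i) ^ 4 = ((\<Prod>i<n. \<epsilon> i)\<^sup>2)\<^sup>2" by simp
  then show "(\<Prod>i<n. \<epsilon> i) ^ 4 = 1" by (simp only: *) simp
qed

lemma gauss_mean_sum_row_sub_squares:
  assumes "r < n"
  shows "gauss_mean \<kappa> n (\<lambda>Z. (\<Sum>i<n. (row_sub n v i Z)\<^sup>2)\<^sup>2) =
    real n * (real n + 2) / 3 * gauss_mean \<kappa> n (\<lambda>Z. row_sub n v r Z ^ 4)"
proof -
  let ?T = "\<lambda>i Z. row_sub n v i Z"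
  define s where "s = gauss_mean \<kappa> n (\<lambda>Z. ?T r Z ^ 4)"
  have diag: "gauss_mean \<kappa> n (\<lambda>Z. ?T i Z ^ 4) = s" if "i < n" for i
    unfolding s_def by (rule gauss_mean_row_sub_eq[OF that assms, of "\<lambda>x y. y ^ 4"]) simp
  have pair: "gauss_mean \<kappa> n (\<lambda>Z. (?T i Z)\<^sup>2 * (?T k Z)\<^sup>2) = s / 3 + (if i = k then 2 * s / 3 else 0)"
    if "i < n" "k < n" for i k
    using gauss_mean_two_rows[OF that, of \<kappa> v] diag[OF that(1)]
    by (auto simp: power4_eq_xxxx power2_eq_square mult.assoc)
  have "gauss_mean \<kappa> n (\<lambda>Z. (\<Sum>i<n. (?T i Z)\<^sup>2)\<^sup>2) =
      (\<Sum>i<n. \<Sum>k<n. s / 3 + (if i = k then 2 * s / 3 else 0))"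
    by (simp only: grid_mean_sum power2_eq_square[of "sum _ _"] sum_product) (simp add: pair)
  also have "\<dots> = real n * (real n + 2) / 3 * s"
    by (simp add: sum.distrib) (simp add: field_simps)
  finally show ?thesis unfolding s_def .
qed

text \<open>This is rotational invariance in disguise: a sum of \<open>n\<close> replaced rows behaves like a single
  one scaled by the length \<open>\<surd>n\<close> of the vector \<open>(1, \<dots>, 1)\<close>. It uses that random signs have the
  moments \<open>0, 1, 0, 1\<close>.\<close>

lemma gauss_mean_sum_row_sub_power4:
  assumes "r < n"
  shows "gauss_mean \<kappa> n (\<lambda>Z. (\<Sum>i<n. row_sub n v i Z) ^ 4) =
      (real n)\<^sup>2 * gauss_mean \<kappa> n (\<lambda>Z. row_sub n v r Z ^ 4)"
proof -
  let ?T = "\<lambda>i Z. row_sub n v i Z"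
  define s where "s = gauss_mean \<kappa> n (\<lambda>Z. ?T r Z ^ 4)"
  have diag: "gauss_mean \<kappa> n (\<lambda>Z. ?T i Z ^ 4) = s" if "i < n" for i
    unfolding s_def by (rule gauss_mean_row_sub_eq[OF that assms, of "\<lambda>x y. y ^ 4"]) simp
  have "gauss_mean \<kappa> n (\<lambda>Z. (\<Sum>i<n. ?T i Z) ^ 4) =
      gauss_mean \<kappa> n (\<lambda>Z. 3 * (\<Sum>i<n. (?T i Z)\<^sup>2)\<^sup>2 + (- 2) * (\<Sum>i<n. ?T i Z ^ 4))"
  proof (rule gauss_mean_average_signs)
    fix \<epsilon> :: "nat \<Rightarrow> real" and Z assume \<epsilon>: "\<And>i. \<epsilon> i \<in> {-1, 1}"
    have "(\<Sum>i<n. ?T i (\<lambda>c. \<epsilon> (fst c) * Z c)) = (\<Prod>i<n. \<epsilon> i) * (\<Sum>i<n. \<epsilon> i * ?T i Z)"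
      by (simp add: row_sub_row_signs[where \<epsilon>=\<epsilon>, OF \<epsilon>] sum_distrib_left)
    then show "(\<Sum>i<n. ?T i (\<lambda>c. \<epsilon> (fst c) * Z c)) ^ 4 = (0 + (\<Sum>i<n. \<epsilon> i * ?T i Z)) ^ 4"
      by (simp add: power_mult_distrib prod_signs_power[where \<epsilon>=\<epsilon>, OF \<epsilon>])
  next
    fix Z
    show "grid_mean {- 1, 1} (\<lambda>_. 1 / 2) {..<n} (\<lambda>\<epsilon>. (0 + (\<Sum>i<n. \<epsilon> i * ?T i Z)) ^ 4) (\<lambda>_. 1) =
         3 * (\<Sum>i<n. (?T i Z)\<^sup>2)\<^sup>2 + (- 2) * (\<Sum>i<n. ?T i Z ^ 4)"
      by (subst grid_mean_linear_form_power4[where p=1 and q=1]) auto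
  qed
  also have "\<dots> = 3 * (real n * (real n + 2) / 3 * s) + (- 2) * (\<Sum>i<n. gauss_mean \<kappa> n (\<lambda>Z. ?T i Z ^ 4))"
    by (simp only: grid_mean_add grid_mean_cmult grid_mean_sum gauss_mean_sum_row_sub_squares[OF assms]
        s_def)
  also have "\<dots> = (real n)\<^sup>2 * s"
    by (simp add: diag) (simp add: power2_eq_square field_simps)
  finally show ?thesis unfolding s_def .
qed

lemma gauss_mean_even_sum_row_sub_power2:
  assumes "\<And>\<epsilon> Z. (\<And>i. \<epsilon> i \<in> {-1, 1 :: real}) \<Longrightarrow> G (\<lambda>c. \<epsilon> (fst c) * Z c) = G Z"
  shows "gauss_mean \<kappa> n (\<lambda>Z. G Z * (\<Sum>i<n. row_sub n v i Z)\<^sup>2) =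
      gauss_mean \<kappa> n (\<lambda>Z. G Z * (\<Sum>i<n. (row_sub n v i Z)\<^sup>2))"
proof (rule gauss_mean_average_signs)
  let ?T = "\<lambda>i Z. row_sub n v i Z"
  fix \<epsilon> :: "nat \<Rightarrow> real" and Z assume \<epsilon>: "\<And>i. \<epsilon> i \<in> {-1, 1}"
  have "(\<Sum>i<n. ?T i (\<lambda>c. \<epsilon> (fst c) * Z c)) = (\<Prod>i<n. \<epsilon> i) * (\<Sum>i<n. \<epsilon> i * ?T i Z)"
    by (simp add: row_sub_row_signs[where \<epsilon>=\<epsilon>, OF \<epsilon>] sum_distrib_left)
  then show "G (\<lambda>c. \<epsilon> (fst c) * Z c) * (\<Sum>i<n. ?T i (\<lambda>c. \<epsilon> (fst c) * Z c))\<^sup>2 =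
      G Z * (0 + (\<Sum>i<n. \<epsilon> i * ?T i Z))\<^sup>2"
    by (simp add: power_mult_distrib prod_signs_power[where \<epsilon>=\<epsilon>, OF \<epsilon>] assms[where \<epsilon>=\<epsilon>, OF \<epsilon>])
next
  let ?T = "\<lambda>i Z. row_sub n v i Z"
  fix Z
  show "grid_mean {- 1, 1} (\<lambda>_. 1 / 2) {..<n} (\<lambda>\<epsilon>. G Z * (0 + (\<Sum>i<n. \<epsilon> i * ?T i Z))\<^sup>2) (\<lambda>_. 1) =
      G Z * (\<Sum>i<n. (?T i Z)\<^sup>2)"
    unfolding grid_mean_cmult by (subst grid_mean_linear_form_power2[where p=1]) auto
qed

text \<open>Changing the sign of every row multiplies the integrand by \<open>-1\<close>.\<close>

lemma gauss_mean_odd: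
  assumes "odd r" "even (q + r)"
  shows "gauss_mean \<kappa> n (\<lambda>Z. fdet n Z ^ q * (\<Sum>i<n. row_sub n v i Z) ^ r) = 0"
proof -
  have sgn: "\<And>i :: nat. (\<lambda>_. -1 :: real) i \<in> {-1, 1}" by simp
  have "gauss_mean \<kappa> n (\<lambda>Z. fdet n Z ^ q * (\<Sum>i<n. row_sub n v i Z) ^ r) =
    gauss_mean \<kappa> n (\<lambda>Z. fdet n (\<lambda>c. (\<lambda>_. -1) (fst c) * Z c) ^ q *
        (\<Sum>i<n. row_sub n v i (\<lambda>c. (\<lambda>_. -1) (fst c) * Z c)) ^ r)"
    by (rule gauss_mean_row_signs[OF sgn, symmetric])
  also have "\<dots> = gauss_mean \<kappa> n (\<lambda>Z. (-1) * (fdet n Z ^ q * (\<Sum>i<n. row_sub n v i Z) ^ r))"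
  proof (rule grid_mean_cong)
    fix Z :: "nat \<times> nat \<Rightarrow> real"
    define P :: real where "P = (\<Prod>i<n. -1)"
    have "P ^ (q + r) = 1"
      using assms(2) by (auto simp: P_def uminus_power_if)
    moreover have "(\<Sum>i<n. row_sub n v i (\<lambda>c. (\<lambda>_. -1) (fst c) * Z c)) = - (P * (\<Sum>i<n. row_sub n v i Z))"
      using row_sub_row_signs[OF sgn, of _ n v Z]
      by (simp add: P_def sum_distrib_left sum_negf)
    moreover have "fdet n (\<lambda>c. (\<lambda>_. -1) (fst c) * Z c) = P * fdet n Z"
      using fdet_scale_rows[of n "\<lambda>_. -1" Z] by (simp add: P_def)
    ultimately show "fdet n (\<lambda>c. (\<lambda>_. -1) (fst c) * Z c) ^ q *
        (\<Sum>i<n. row_sub n v i (\<lambda>c. (\<lambda>_. -1) (fst c) * Z c)) ^ r =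
      (-1) * (fdet n Z ^ q * (\<Sum>i<n. row_sub n v i Z) ^ r)"
      using assms(1)
          by (simp only: power_mult_distrib power_minus_odd power_add mult_minus_left mult_minus_right)
              (simp add: algebra_simps)
  qed
  finally show ?thesis by (simp only: grid_mean_cmult)
qed

section \<open>The Gaussian fourth moments in closed form\<close>

lemma gauss_mean_minor: "gauss_mean \<kappa> (Suc m) (\<lambda>Z. fdet m Z ^ 4) = gauss_mean \<kappa> m (\<lambda>Z. fdet m Z ^ 4)"
proof -
  let ?w = "grid_weight \<kappa> 0 (3 * \<kappa>\<^sup>2)" and ?R = "cells (Suc m) - cells m"
  have cells: "cells (Suc m) = cells m \<union> ?R" by (auto simp: cells_def)
  have "grid_mean grid ?w ?R (\<lambda>Z. fdet m Z ^ 4) Z = grid_mean grid ?w ?R (\<lambda>_. fdet m Z ^ 4) Z" for Z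
    by (rule grid_mean_cong, rule arg_cong[where f="\<lambda>x. x ^ 4"], rule fdet_cong) (simp add: cells_def)
  then have R: "grid_mean grid ?w ?R (\<lambda>Z. fdet m Z ^ 4) = (\<lambda>Z. fdet m Z ^ 4)"
    by (simp add: fun_eq_iff grid_mean_const grid_weight_moments)
  have "gauss_mean \<kappa> (Suc m) (\<lambda>Z. fdet m Z ^ 4) =
      grid_mean grid ?w (cells m) (grid_mean grid ?w ?R (\<lambda>Z. fdet m Z ^ 4)) (\<lambda>_. 0)"
    by (subst cells, rule grid_mean_union) auto
  then show ?thesis unfolding R .
qed

lemma row_sub_unit:
  assumes "i < n" "m < n"
  shows "row_sub n (\<lambda>q. if q = m then 1 else 0) i Z = fcof n Z i m"
  using assms by (simp add: row_sub_def fdet_set_row if_distrib[of "\<lambda>x. x * _"] sum.delta cong: if_cong)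

lemma row_sub_ones: "i < n \<Longrightarrow> row_sub n (\<lambda>_. 1) i Z = (\<Sum>j<n. fcof n Z i j)"
  by (simp add: row_sub_def fdet_set_row)

abbreviation fdet_mean4 :: "real \<Rightarrow> nat \<Rightarrow> real" where
  "fdet_mean4 \<kappa> n \<equiv> gauss_mean \<kappa> n (\<lambda>Z. fdet n Z ^ 4)"

abbreviation last_cof :: "nat \<Rightarrow> nat \<Rightarrow> (nat \<times> nat \<Rightarrow> real) \<Rightarrow> real" where
  "last_cof m j Z \<equiv> fcof (Suc m) Z m j"

abbreviation last_unit :: "nat \<Rightarrow> nat \<Rightarrow> real" where
  "last_unit m \<equiv> (\<lambda>q. if q = m then 1 else 0)"

lemma gauss_mean_row_sub_unit_power4:
  "gauss_mean \<kappa> (Suc m) (\<lambda>Z. row_sub (Suc m) (last_unit m) m Z ^ 4) = fdet_mean4 \<kappa> m"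
  using gauss_mean_minor[of \<kappa> m] by (simp add: row_sub_unit fcof_last)

text \<open>Transposition turns the cofactors of the last row into those of the last column, which are
  determinants with a replaced row. The cut-off at \<open>Suc m\<close> is there because cofactors outside the
  matrix have no such description.\<close>

lemma gauss_mean_last_cofactors:
  "gauss_mean \<kappa> (Suc m) (\<lambda>Z. h (\<lambda>j. if j < Suc m then last_cof m j Z else 0)) =
   gauss_mean \<kappa> (Suc m) (\<lambda>Z. h (\<lambda>j. if j < Suc m then row_sub (Suc m) (last_unit m) j Z else 0))"
proof -
  have "(\<lambda>j. if j < Suc m then last_cof m j Z else 0) =
      (\<lambda>j. if j < Suc m then row_sub (Suc m) (last_unit m) j (Z \<circ> prod.swap) else 0)" for Z
    by (auto simp: fun_eq_iff row_sub_unit fcof_transpose)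
  then show ?thesis
    using gauss_mean_transpose[of \<kappa> "Suc m"
        "\<lambda>Z. h (\<lambda>j. if j < Suc m then row_sub (Suc m) (last_unit m) j Z else 0)"]
    by (simp only:)
qed

lemma gauss_mean_cofactor_sum_power4:
  "gauss_mean \<kappa> (Suc m) (\<lambda>Z. (\<Sum>j<Suc m. last_cof m j Z) ^ 4) = (real (Suc m))\<^sup>2 * fdet_mean4 \<kappa> m"
  using gauss_mean_last_cofactors[of \<kappa> m "\<lambda>c. (\<Sum>j<Suc m. c j) ^ 4"]
    gauss_mean_sum_row_sub_power4[of m "Suc m" \<kappa> "last_unit m"]
  by (simp add: gauss_mean_row_sub_unit_power4 del: sum.lessThan_Suc of_nat_Suc)

lemma gauss_mean_cofactor_squares:
  "gauss_mean \<kappa> (Suc m) (\<lambda>Z. (\<Sum>j<Suc m. (last_cof m j Z)\<^sup>2)\<^sup>2) =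
    real (Suc m) * (real (Suc m) + 2) / 3 * fdet_mean4 \<kappa> m"
  using gauss_mean_last_cofactors[of \<kappa> m "\<lambda>c. (\<Sum>j<Suc m. (c j)\<^sup>2)\<^sup>2"]
    gauss_mean_sum_row_sub_squares[of m "Suc m" \<kappa> "last_unit m"]
  by (simp add: gauss_mean_row_sub_unit_power4 del: sum.lessThan_Suc of_nat_Suc)

lemma gauss_mean_cofactor_mixed:
  "gauss_mean \<kappa> (Suc m) (\<lambda>Z. (\<Sum>j<Suc m. (last_cof m j Z)\<^sup>2) * (\<Sum>j<Suc m. last_cof m j Z)\<^sup>2) =
    real (Suc m) * (real (Suc m) + 2) / 3 * fdet_mean4 \<kappa> m"
proof -
  let ?T = "row_sub (Suc m) (last_unit m)"
  have "gauss_mean \<kappa> (Suc m) (\<lambda>Z. (\<Sum>j<Suc m. (last_cof m j Z)\<^sup>2) * (\<Sum>j<Suc m. last_cof m j Z)\<^sup>2) =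
      gauss_mean \<kappa> (Suc m) (\<lambda>Z. (\<Sum>j<Suc m. (?T j Z)\<^sup>2) * (\<Sum>j<Suc m. ?T j Z)\<^sup>2)"
    using gauss_mean_last_cofactors[of \<kappa> m "\<lambda>c. (\<Sum>j<Suc m. (c j)\<^sup>2) * (\<Sum>j<Suc m. c j)\<^sup>2"]
    by (simp del: sum.lessThan_Suc)
  also have "\<dots> = gauss_mean \<kappa> (Suc m) (\<lambda>Z. (\<Sum>j<Suc m. (?T j Z)\<^sup>2) * (\<Sum>j<Suc m. (?T j Z)\<^sup>2))"
  proof (rule gauss_mean_even_sum_row_sub_power2)
    fix \<epsilon> :: "nat \<Rightarrow> real" and Z assume \<epsilon>: "\<And>i. \<epsilon> i \<in> {-1, 1}"
    have "(\<epsilon> i)\<^sup>2 = 1" for i using \<epsilon>[of i] by auto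
    then show "(\<Sum>j<Suc m. (?T j (\<lambda>c. \<epsilon> (fst c) * Z c))\<^sup>2) = (\<Sum>j<Suc m. (?T j Z)\<^sup>2)"
      by (simp add: row_sub_row_signs[where \<epsilon>=\<epsilon>, OF \<epsilon>] prod_signs_power[where \<epsilon>=\<epsilon>, OF \<epsilon>]
          power_mult_distrib
          del: sum.lessThan_Suc prod.lessThan_Suc)
  qed
  also have "\<dots> = real (Suc m) * (real (Suc m) + 2) / 3 * fdet_mean4 \<kappa> m"
    using gauss_mean_sum_row_sub_squares[of m "Suc m" \<kappa> "last_unit m"]
    by (simp only: gauss_mean_row_sub_unit_power4 power2_eq_square[of "sum _ _"] lessI)
  finally show ?thesis .
qed

lemma last_cof_indep:
  assumes "l < Suc m" "\<And>p q. p \<noteq> m \<Longrightarrow> Z' (p, q) = Z (p, q)"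
  shows "last_cof m l Z' = last_cof m l Z"
  using assms by (intro fcof_cong) auto

text \<open>Given the other rows, the determinant is a linear form in the last row.\<close>

lemma gauss_mean_fdet_power4:
  "fdet_mean4 \<kappa> (Suc m) = \<kappa>\<^sup>2 * (real (Suc m) * (real (Suc m) + 2)) * fdet_mean4 \<kappa> m"
proof -
  have "fdet_mean4 \<kappa> (Suc m) = gauss_mean \<kappa> (Suc m) (\<lambda>Z. (\<Sum>l<Suc m. Z (m, l) * last_cof m l Z) ^ 4)"
    by (simp only: fdet_expand_row[of m "Suc m", OF lessI])
  also have "\<dots> = 3 * \<kappa>\<^sup>2 * gauss_mean \<kappa> (Suc m) (\<lambda>Z. (\<Sum>l<Suc m. (last_cof m l Z)\<^sup>2)\<^sup>2)"
    by (rule gauss_mean_row_power4[OF lessI last_cof_indep])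
  finally show ?thesis by (simp only: gauss_mean_cofactor_squares) simp
qed

lemma gauss_mean_sum_row_sub_ones_power4:
  "gauss_mean \<kappa> (Suc m) (\<lambda>Z. (\<Sum>i<Suc m. row_sub (Suc m) (\<lambda>_. 1) i Z) ^ 4) =
    real (Suc m) ^ 4 * fdet_mean4 \<kappa> m"
  by (simp only: gauss_mean_sum_row_sub_power4[OF lessI] row_sub_ones[OF lessI]
      gauss_mean_cofactor_sum_power4)
     (simp add: power4_eq_xxxx power2_eq_square del: of_nat_Suc)

text \<open>Row signs remove the mixed terms of the square of the sum, and all rows contribute like the
  last one, for which the replaced determinant does not involve the row that is integrated.\<close>

lemma gauss_mean_fdet_sum_row_sub_ones:
  "gauss_mean \<kappa> (Suc m) (\<lambda>Z. (fdet (Suc m) Z)\<^sup>2 * (\<Sum>i<Suc m. row_sub (Suc m) (\<lambda>_. 1) i Z)\<^sup>2) =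
   \<kappa> * (real (Suc m))\<^sup>2 * (real (Suc m) + 2) / 3 * fdet_mean4 \<kappa> m"
proof -
  let ?n = "Suc m"
  let ?S = "row_sub ?n (\<lambda>_. 1)"
  have "gauss_mean \<kappa> ?n (\<lambda>Z. (fdet ?n Z)\<^sup>2 * (\<Sum>i<?n. ?S i Z)\<^sup>2) =
      gauss_mean \<kappa> ?n (\<lambda>Z. (fdet ?n Z)\<^sup>2 * (\<Sum>i<?n. (?S i Z)\<^sup>2))"
  proof (rule gauss_mean_even_sum_row_sub_power2)
    fix \<epsilon> :: "nat \<Rightarrow> real" and Z assume \<epsilon>: "\<And>i. \<epsilon> i \<in> {-1, 1}"
    show "(fdet ?n (\<lambda>c. \<epsilon> (fst c) * Z c))\<^sup>2 = (fdet ?n Z)\<^sup>2"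
      by (simp only: fdet_scale_rows power_mult_distrib prod_signs_power[where \<epsilon>=\<epsilon>, OF \<epsilon>] mult_1)
  qed
  also have "\<dots> = (\<Sum>i<?n. gauss_mean \<kappa> ?n (\<lambda>Z. (fdet ?n Z)\<^sup>2 * (?S i Z)\<^sup>2))"
    by (simp only: sum_distrib_left grid_mean_sum)
  also have "\<dots> = (\<Sum>i<?n. gauss_mean \<kappa> ?n (\<lambda>Z. (fdet ?n Z)\<^sup>2 * (?S m Z)\<^sup>2))"
    by (rule sum.cong[OF refl], rule gauss_mean_row_sub_eq[where h="\<lambda>x y. x\<^sup>2 * y\<^sup>2"]) auto
  also have "gauss_mean \<kappa> ?n (\<lambda>Z. (fdet ?n Z)\<^sup>2 * (?S m Z)\<^sup>2) =
      gauss_mean \<kappa> ?n (\<lambda>Z. (\<Sum>l<?n. Z (m, l) * last_cof m l Z)\<^sup>2 * (\<Sum>l<?n. last_cof m l Z)\<^sup>2)"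
    by (simp only: fdet_expand_row[of m "Suc m", OF lessI] row_sub_ones[OF lessI])
  also have "\<dots> = \<kappa> * gauss_mean \<kappa> ?n (\<lambda>Z. (\<Sum>l<?n. (last_cof m l Z)\<^sup>2) * (\<Sum>l<?n. last_cof m l Z)\<^sup>2)"
  proof (rule gauss_mean_row_power2[OF lessI last_cof_indep])
    fix Z Z' :: "nat \<times> nat \<Rightarrow> real" assume *: "\<And>p q. p \<noteq> m \<Longrightarrow> Z' (p, q) = Z (p, q)"
    have "(\<Sum>l<?n. last_cof m l Z') = (\<Sum>l<?n. last_cof m l Z)"
      by (rule sum.cong[OF refl], rule last_cof_indep, simp, erule *)
    then show "(\<Sum>l<?n. last_cof m l Z')\<^sup>2 = (\<Sum>l<?n. last_cof m l Z)\<^sup>2" by simp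
  qed
  finally show ?thesis
    by (simp only: gauss_mean_cofactor_mixed) (simp add: power2_eq_square del: of_nat_Suc)
qed

lemma gauss_mean_fdet_power4_eq:
  "gauss_mean \<kappa> n (\<lambda>Z. fdet n Z ^ 4) = (fact n)\<^sup>2 * \<kappa> ^ (2 * n) * ((real n + 1) * (real n + 2) / 2)"
proof (induction n)
  case 0
  then show ?case by (simp add: fdet_def cells_def)
next
  case (Suc n)
  show ?case
    unfolding gauss_mean_fdet_power4 Suc by (simp add: power2_eq_square field_simps)
qed

lemma gauss_mean_sum_row_sub_ones_power4_eq:
  assumes "\<kappa> \<noteq> 0"
  shows "gauss_mean \<kappa> n (\<lambda>Z. (\<Sum>i<n. row_sub n (\<lambda>_. 1) i Z) ^ 4) =
    (fact n)\<^sup>2 * \<kappa> ^ (2 * n) * (real n ^ 3 * (real n + 1) / 2) / \<kappa>\<^sup>2"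
proof (cases n)
  case (Suc m)
  show ?thesis
    unfolding Suc gauss_mean_sum_row_sub_ones_power4 gauss_mean_fdet_power4_eq
    using assms by (simp add: field_simps power2_eq_square power3_eq_cube power4_eq_xxxx)
qed (simp add: cells_def)

lemma gauss_mean_fdet_sum_row_sub_ones_eq:
  assumes "\<kappa> \<noteq> 0"
  shows "gauss_mean \<kappa> n (\<lambda>Z. (fdet n Z)\<^sup>2 * (\<Sum>i<n. row_sub n (\<lambda>_. 1) i Z)\<^sup>2) =
    (fact n)\<^sup>2 * \<kappa> ^ (2 * n) * (real n * (real n + 1) * (real n + 2) / 6) / \<kappa>"
proof (cases n)
  case (Suc m)
  show ?thesis
    unfolding Suc gauss_mean_fdet_sum_row_sub_ones gauss_mean_fdet_power4_eq
    using assms by (simp add: field_simps power2_eq_square)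
qed (simp add: cells_def)

text \<open>With \<open>D = det Y\<close> and \<open>S\<close> the sum of all cofactors the integrand is \<open>(D + a S)\<^sup>j D\<^sup>4\<^sup>-\<^sup>j\<close>.
  The odd powers of \<open>S\<close> have mean zero.\<close>

lemma mixed_moment_gauss:
  assumes \<kappa>: "\<kappa> \<noteq> 0" and j: "j \<le> 4"
  shows "mixed_moment \<kappa> 0 0 a j n = (fact n)\<^sup>2 * \<kappa> ^ (2 * n) *
    ((real n + 1) * (real n + 2) / 2
      + real (j choose 2) * a\<^sup>2 * (real n * (real n + 1) * (real n + 2) / 6) / \<kappa>
      + (if j = 4 then a ^ 4 * (real n ^ 3 * (real n + 1) / 2) / \<kappa>\<^sup>2 else 0))"
proof -
  let ?D = "\<lambda>Z. fdet n Z" and ?S = "\<lambda>Z. \<Sum>i<n. row_sub n (\<lambda>_. 1) i Z"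
  have shift: "fdet n (\<lambda>c. Z c + a) = ?D Z + a * ?S Z" for Z
    by (simp add: fdet_add_const row_sub_def)
  have odd: "gauss_mean \<kappa> n (\<lambda>Z. ?D Z ^ 3 * ?S Z) = 0" "gauss_mean \<kappa> n (\<lambda>Z. ?D Z * ?S Z ^ 3) = 0"
    using gauss_mean_odd[of 1 3 \<kappa> n "\<lambda>_. 1"] gauss_mean_odd[of 3 1 \<kappa> n "\<lambda>_. 1"] by simp_all
  have expand: "(?D Z + a * ?S Z) ^ j * ?D Z ^ (4 - j) =
     ?D Z ^ 4 + (real j * a * (?D Z ^ 3 * ?S Z) + (real (j choose 2) * a\<^sup>2 * ((?D Z)\<^sup>2 * (?S Z)\<^sup>2)
      + (real (j choose 3) * a ^ 3 * (?D Z * ?S Z ^ 3) + (if j = 4 then a ^ 4 else 0) * ?S Z ^ 4)))"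
          for Z
  proof -
    consider "j = 0" | "j = 1" | "j = 2" | "j = 3" | "j = 4" using j by linarith
    then show ?thesis
      by cases (simp_all add: numeral_eq_Suc algebra_simps)
  qed
  show ?thesis
    unfolding mixed_moment_def shift expand
    by (simp only: grid_mean_add grid_mean_cmult odd gauss_mean_fdet_power4_eq
        gauss_mean_fdet_sum_row_sub_ones_eq[OF \<kappa>]
        gauss_mean_sum_row_sub_ones_power4_eq[OF \<kappa>] add_0) (simp add: algebra_simps)
qed

section \<open>Solving for the cumulants\<close>

lemma fact_Suc_cancel: "real (Suc p) * x / fact (Suc p) = x / fact p"
  by (simp del: of_nat_Suc)

lemma fact_Suc_cancel_square: "(real (Suc p))\<^sup>2 * x / (fact (Suc p))\<^sup>2 = x / (fact p)\<^sup>2"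
  by (simp add: power_mult_distrib del: of_nat_Suc)

text \<open>Functions whose derivatives are \<open>b\<close> times their predecessors are Taylor polynomials with the
  initial values as coefficients. Both cumulants are removed in this way.\<close>

lemma taylor_chain:
  fixes \<psi> :: "nat \<Rightarrow> real \<Rightarrow> real"
  assumes base: "\<And>t. (\<psi> 0 has_real_derivative 0) (at t)"
    and step: "\<And>k t. k < K \<Longrightarrow> (\<psi> (Suc k) has_real_derivative b * \<psi> k t) (at t)"
    and "k \<le> K"
  shows "\<psi> k t = (\<Sum>p\<le>k. (b * t) ^ p / fact p * \<psi> (k - p) 0)"
  using \<open>k \<le> K\<close>
proof (induction k arbitrary: t)
  case 0
  have "\<psi> 0 t = \<psi> 0 0" by (rule DERIV_isconst_all) (use base in blast)
  then show ?case by simp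
next
  case (Suc k)
  define P where "P = (\<lambda>t. \<Sum>p\<le>Suc k. (b * t) ^ p / fact p * \<psi> (Suc k - p) 0)"
  have P: "P = (\<lambda>t. \<psi> (Suc k) 0 + (\<Sum>p\<le>k. (b * t) ^ Suc p / fact (Suc p) * \<psi> (k - p) 0))"
    unfolding P_def by (subst sum.atMost_Suc_shift) simp
  have "((\<lambda>t. (b * t) ^ Suc p / fact (Suc p) * c) has_real_derivative b * ((b * t) ^ p / fact p * c))
      (at t)" for p t c
  proof -
    have "((\<lambda>t. (b * t) ^ Suc p) has_real_derivative real (Suc p) * (b * (b * t) ^ p)) (at t)"
      by (rule DERIV_cong[OF DERIV_power_Suc[OF DERIV_cmult_Id]]) simp
    from DERIV_cmult_right[OF DERIV_cdivide[OF this, of "fact (Suc p)"], of c] show ?thesis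
      unfolding fact_Suc_cancel by (simp add: mult_ac)
  qed
  then have "(P has_real_derivative 0 + (\<Sum>p\<le>k. b * ((b * t) ^ p / fact p * \<psi> (k - p) 0))) (at t)" for t
    unfolding P by (intro DERIV_add DERIV_const DERIV_sum)
  moreover have "b * \<psi> k t = 0 + (\<Sum>p\<le>k. b * ((b * t) ^ p / fact p * \<psi> (k - p) 0))" for t
    using Suc by (simp add: sum_distrib_left)
  ultimately have "((\<lambda>t. \<psi> (Suc k) t - P t) has_real_derivative 0) (at t)" for t
    using DERIV_diff[OF step[of k t]] Suc.prems by fastforce
  then have "\<psi> (Suc k) t - P t = \<psi> (Suc k) 0 - P 0"
    by (intro DERIV_isconst_all[of "\<lambda>t. \<psi> (Suc k) t - P t"]) blast
  moreover have "P 0 = \<psi> (Suc k) 0" unfolding P by simp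
  ultimately show ?case by (simp add: P_def)
qed

lemma mixed_moment_fourth_cumulant:
  "mixed_moment \<kappa>\<^sub>2 \<kappa>\<^sub>3 \<kappa>\<^sub>4 a 4 n / (fact n)\<^sup>2 =
      (\<Sum>j\<le>n. \<kappa>\<^sub>4 ^ j / fact j * (mixed_moment \<kappa>\<^sub>2 \<kappa>\<^sub>3 0 a 4 (n - j) / (fact (n - j))\<^sup>2))"
proof -
  define \<psi> where "\<psi> = (\<lambda>n t. mixed_moment \<kappa>\<^sub>2 \<kappa>\<^sub>3 t a 4 n / (fact n)\<^sup>2)"
  have "\<psi> n \<kappa>\<^sub>4 = (\<Sum>j\<le>n. (1 * \<kappa>\<^sub>4) ^ j / fact j * \<psi> (n - j) 0)"
  proof (rule taylor_chain[where K=n])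
    fix k t
    have "((\<lambda>t. mixed_moment \<kappa>\<^sub>2 \<kappa>\<^sub>3 t a 4 (Suc k)) has_real_derivative (real (Suc k))\<^sup>2 *
        mixed_moment \<kappa>\<^sub>2 \<kappa>\<^sub>3 t a 4 k) (at t)"
      using mixed_moment_deriv[of 4 \<kappa>\<^sub>2 \<kappa>\<^sub>3 0 0 1 a k t] by simp
    from DERIV_cdivide[OF this, of "(fact (Suc k))\<^sup>2"]
    show "(\<psi> (Suc k) has_real_derivative 1 * \<psi> k t) (at t)"
      unfolding fact_Suc_cancel_square by (simp add: \<psi>_def)
  qed (simp_all add: \<psi>_def mixed_moment_0)
  then show ?thesis by (simp add: \<psi>_def)
qed

text \<open>Each derivative lowers the size of the matrix and the number of shifted factors together,
  and after four of them no shifted factor is left. At size \<open>0\<close> the chain ends earlier; this is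
  why the terms with \<open>n < p\<close> are absent.\<close>

lemma mixed_moment_third_cumulant:
  "mixed_moment \<kappa>\<^sub>2 \<kappa>\<^sub>3 0 a 4 n / (fact n)\<^sup>2 =
    (\<Sum>p\<le>4.
        if n < p then 0 else real (4 choose p) * (a * \<kappa>\<^sub>3) ^ p *
            (mixed_moment \<kappa>\<^sub>2 0 0 a (4 - p) (n - p) / (fact (n - p))\<^sup>2))"
proof -
  \<comment> \<open>\<open>k\<close> shifted factors belong to size \<open>n + k - 4\<close>, so that \<open>k = 4\<close> is the function to be
      expanded; sizes below \<open>0\<close> contribute nothing.\<close>
  define \<psi> where "\<psi> =
      (\<lambda>k t.
          if n + k < 4 then 0 else mixed_moment \<kappa>\<^sub>2 t 0 a k (n + k - 4) / (fact (n + k - 4))\<^sup>2 /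
              fact k)"
  have "\<psi> 4 \<kappa>\<^sub>3 = (\<Sum>p\<le>4. (a * \<kappa>\<^sub>3) ^ p / fact p * \<psi> (4 - p) 0)"
  proof (rule taylor_chain[where K=4])
    fix t
    show "(\<psi> 0 has_real_derivative 0) (at t)"
    proof (cases "n \<le> 4")
      case True
      then have "\<psi> 0 = (\<lambda>t. \<psi> 0 0)" by (auto simp: \<psi>_def mixed_moment_0 fun_eq_iff)
      then show ?thesis using DERIV_const by metis
    next
      case False
      then obtain l where l: "n - 4 = Suc l" by (metis Suc_diff_Suc not_le)
      have "((\<lambda>t. mixed_moment \<kappa>\<^sub>2 t 0 a 0 (Suc l)) has_real_derivative 0) (at t)"
        using mixed_moment_deriv[of 0 \<kappa>\<^sub>2 0 1 0 0 a l t] by simp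
      from DERIV_cdivide[OF this, of "(fact (Suc l))\<^sup>2"] False show ?thesis
        by (simp add: \<psi>_def l)
    qed
  next
    fix k :: nat and t assume k: "k < 4"
    show "(\<psi> (Suc k) has_real_derivative a * \<psi> k t) (at t)"
    proof (cases "n + k < 4")
      case True
      then have "\<psi> (Suc k) = (\<lambda>t. \<psi> (Suc k) 0)" by (auto simp: \<psi>_def mixed_moment_0 fun_eq_iff)
      moreover have "a * \<psi> k t = 0" using True by (simp add: \<psi>_def)
      ultimately show ?thesis using DERIV_const by metis
    next
      case False
      define l where "l = n + k - 4"
      have l: "n + Suc k - 4 = Suc l" "n + k - 4 = l" using False by (auto simp: l_def)
      have "((\<lambda>t. mixed_moment \<kappa>\<^sub>2 t 0 a (Suc k) (Suc l)) has_real_derivative (real (Suc l))\<^sup>2 *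
          (real (Suc k) * a * mixed_moment \<kappa>\<^sub>2 t 0 a k l)) (at t)"
        using mixed_moment_deriv[of "Suc k" \<kappa>\<^sub>2 0 1 0 0 a l t] k by simp
      from DERIV_cdivide[OF DERIV_cdivide[OF this, of "(fact (Suc l))\<^sup>2"], of "fact (Suc k)"]
      have "((\<lambda>t. mixed_moment \<kappa>\<^sub>2 t 0 a (Suc k) (Suc l) / (fact (Suc l))\<^sup>2 /
          fact (Suc k)) has_real_derivative
         a * (mixed_moment \<kappa>\<^sub>2 t 0 a k l / (fact l)\<^sup>2 / fact k)) (at t)"
      proof (rule DERIV_cong)
        have "(real (Suc l))\<^sup>2 * (real (Suc k) * a * M) / (fact (Suc l))\<^sup>2 / fact (Suc k) =
            a * (real (Suc k) * (M / (fact l)\<^sup>2) / fact (Suc k))" for M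
          unfolding fact_Suc_cancel_square by (simp add: mult_ac del: of_nat_Suc fact_Suc)
        then show "(real (Suc l))\<^sup>2 * (real (Suc k) * a * mixed_moment \<kappa>\<^sub>2 t 0 a k l) /
            (fact (Suc l))\<^sup>2 / fact (Suc k) =
            a * (mixed_moment \<kappa>\<^sub>2 t 0 a k l / (fact l)\<^sup>2 / fact k)"
          unfolding fact_Suc_cancel .
      qed
      moreover have "\<not> n + Suc k < 4" using False by simp
      ultimately show ?thesis
        using False by (simp only: \<psi>_def l if_False)
    qed
  qed simp
  moreover have "mixed_moment \<kappa>\<^sub>2 \<kappa>\<^sub>3 0 a 4 n / (fact n)\<^sup>2 = fact 4 * \<psi> 4 \<kappa>\<^sub>3"
    by (simp add: \<psi>_def)
  ultimately have "mixed_moment \<kappa>\<^sub>2 \<kappa>\<^sub>3 0 a 4 n / (fact n)\<^sup>2 =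
      (\<Sum>p\<le>4. fact 4 * ((a * \<kappa>\<^sub>3) ^ p / fact p * \<psi> (4 - p) 0))"
    by (simp only: sum_distrib_left)
  also have "\<dots> =
      (\<Sum>p\<le>4.
          if n < p then 0 else real (4 choose p) * (a * \<kappa>\<^sub>3) ^ p *
              (mixed_moment \<kappa>\<^sub>2 0 0 a (4 - p) (n - p) / (fact (n - p))\<^sup>2))"
  proof (rule sum.cong[OF refl])
    fix p :: nat assume p: "p \<in> {..4}"
    then have e: "n + (4 - p) - 4 = n - p" "n + (4 - p) < 4 \<longleftrightarrow> n < p" by auto
    have "real (4 choose p) = fact 4 / (fact p * fact (4 - p))"
      using p by (simp only: binomial_fact atMost_iff)
    then show "fact 4 * ((a * \<kappa>\<^sub>3) ^ p / fact p * \<psi> (4 - p) 0) =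
      (if n < p then 0 else real (4 choose p) * (a * \<kappa>\<^sub>3) ^ p *
          (mixed_moment \<kappa>\<^sub>2 0 0 a (4 - p) (n - p) / (fact (n - p))\<^sup>2))"
      by (simp add: \<psi>_def e mult_ac)
  qed
  finally show ?thesis .
qed

text \<open>The bracket of the Gaussian formula with \<open>b = a\<^sup>2 / \<kappa>\<close>, as a polynomial in a real size \<open>y\<close>.
  It is also evaluated at negative \<open>y\<close>.\<close>

definition gauss_poly :: "real \<Rightarrow> nat \<Rightarrow> real \<Rightarrow> real" where
  "gauss_poly b j y = (y + 1) * (y + 2) / 2 + real (j choose 2) * b * (y * (y + 1) * (y + 2) / 6)
      + (if j = 4 then b\<^sup>2 * (y ^ 3 * (y + 1) / 2) else 0)"

lemma q_coeff_normalised: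
  assumes "\<mu> \<noteq> 0" and s: "s = a * t / \<mu>\<^sup>2" and b: "b = a\<^sup>2 / \<mu>"
  shows "q_coeff a \<mu> t (-2) = s ^ 4"
    "q_coeff a \<mu> t (-1) = - (4 * s ^ 3 * (1 + s))"
    "q_coeff a \<mu> t 0 = 6 * s\<^sup>2 * (1 + 2 * s + s\<^sup>2 - b)"
    "q_coeff a \<mu> t 1 = 12 * b * s - 4 * b\<^sup>2 - 4 * s + 18 * b * s\<^sup>2 - 12 * s\<^sup>2 - 12 * s ^ 3 - 4 * s ^ 4"
    "q_coeff a \<mu> t 2 = 1 + 19 * b\<^sup>2 - 6 * b - 24 * b * s + 4 * s - 18 * b * s\<^sup>2 + 6 * s\<^sup>2 + 4 * s ^ 3 +
        s ^ 4"
    "q_coeff a \<mu> t 3 = 6 * b - 27 * b\<^sup>2 + 12 * b * s + 6 * b * s\<^sup>2"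
    "q_coeff a \<mu> t 4 = 12 * b\<^sup>2"
  using assms(1) unfolding s b q_coeff_def
  by (simp_all add: divide_simps power_divide)
      (simp_all add: algebra_simps power_numeral_reduce power2_eq_square)

lemma choose_poly:
  "real ((N + 1) choose 1) = real N + 1"
  "real ((N + 2) choose 2) = (real N + 1) * (real N + 2) / 2"
  "real ((N + 3) choose 3) = (real N + 1) * (real N + 2) * (real N + 3) / 6"
  "real ((N + 4) choose 4) = (real N + 1) * (real N + 2) * (real N + 3) * (real N + 4) / 24"
proof -
  show "real ((N + 1) choose 1) = real N + 1" by simp
  show 2: "real ((N + 2) choose 2) = (real N + 1) * (real N + 2) / 2" for N
    by (induction N) (simp_all add: numeral_eq_Suc field_simps)
  show 3: "real ((N + 3) choose 3) = (real N + 1) * (real N + 2) * (real N + 3) / 6" for N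
  proof (induction N)
    case (Suc N)
    have "(Suc N + 3) choose 3 = ((N + 3) choose 3) + ((Suc N + 2) choose 2)"
      by (simp add: numeral_eq_Suc)
    then have "real ((Suc N + 3) choose 3) = real ((N + 3) choose 3) + real ((Suc N + 2) choose 2)"
      by (simp only: of_nat_add)
    then show ?case by (simp only: Suc.IH 2) (simp add: field_simps)
  qed simp
  show "real ((N + 4) choose 4) = (real N + 1) * (real N + 2) * (real N + 3) * (real N + 4) / 24"
  proof (induction N)
    case (Suc N)
    have "(Suc N + 4) choose 4 = ((N + 4) choose 4) + ((Suc N + 3) choose 3)"
      by (simp add: numeral_eq_Suc)
    then have "real ((Suc N + 4) choose 4) = real ((N + 4) choose 4) + real ((Suc N + 3) choose 3)"
      by (simp only: of_nat_add)
    then show ?case by (simp only: Suc.IH 3) (simp add: field_simps)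
  qed simp
qed

lemma ext_binom_nonneg: "ext_binom (int N + int i) (int i) = int ((N + i) choose i)"
  by (simp add: ext_binom_def nat_add_distrib)

text \<open>The right-hand side is the sum of \<open>q\<^sub>i\<close> times \<open>binom(x + i, i)\<close> over \<open>0 \<le> i \<le> 4\<close>.\<close>

lemma gauss_poly_sum:
  "(\<Sum>p\<le>4. real (4 choose p) * s ^ p * gauss_poly b (4 - p) (x - real p)) =
     6 * s\<^sup>2 * (1 + 2 * s + s\<^sup>2 - b)
     + (12 * b * s - 4 * b\<^sup>2 - 4 * s + 18 * b * s\<^sup>2 - 12 * s\<^sup>2 - 12 * s ^ 3 - 4 * s ^ 4) * (x + 1)
     + (1 + 19 * b\<^sup>2 - 6 * b - 24 * b * s + 4 * s - 18 * b * s\<^sup>2 + 6 * s\<^sup>2 + 4 * s ^ 3 + s ^ 4) *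
         ((x + 1) * (x + 2) / 2)
     + (6 * b - 27 * b\<^sup>2 + 12 * b * s + 6 * b * s\<^sup>2) * ((x + 1) * (x + 2) * (x + 3) / 6)
     + 12 * b\<^sup>2 * ((x + 1) * (x + 2) * (x + 3) * (x + 4) / 24)"
proof -
  have c: "4 choose 2 = (6::nat)" "4 choose 3 = (4::nat)" "3 choose 2 = (3::nat)" "0 choose 2 =
      (0::nat)" "1 choose 2 = (0::nat)" "Suc 0 choose 2 = (0::nat)"
    by (simp_all add: numeral_eq_Suc)
  have set: "{..4::nat} = {0, 1, 2, 3, 4}" by auto
  have "(\<Sum>p\<le>4. real (4 choose p) * s ^ p * gauss_poly b (4 - p) (x - real p)) =
    gauss_poly b 4 x + 4 * s * gauss_poly b 3 (x - 1) + 6 * s\<^sup>2 * gauss_poly b 2 (x - 2)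
    + 4 * s ^ 3 * gauss_poly b 1 (x - 3) + s ^ 4 * gauss_poly b 0 (x - 4)"
    by (simp add: set c)
  also have "\<dots> =
    ((x + 1) * (x + 2) / 2 + b * (x * (x + 1) * (x + 2)) + b\<^sup>2 * (x ^ 3 * (x + 1) / 2))
    + 4 * s * (x * (x + 1) / 2 + b * ((x - 1) * x * (x + 1) / 2))
    + 6 * s\<^sup>2 * ((x - 1) * x / 2 + b * ((x - 2) * (x - 1) * x / 6))
    + 4 * s ^ 3 * ((x - 2) * (x - 1) / 2) + s ^ 4 * ((x - 3) * (x - 2) / 2)"
    by (simp add: gauss_poly_def c) (simp add: algebra_simps)
  finally show ?thesis
    by (simp add: field_simps power2_eq_square power3_eq_cube power4_eq_xxxx)
qed

text \<open>For \<open>n < p\<close> the polynomial \<open>gauss_poly b (4 - p)\<close> vanishes at \<open>n - p\<close>, with three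
  exceptions: \<open>p = 3\<close> and \<open>p = 4\<close> for \<open>n = 0\<close>, and \<open>p = 4\<close> for \<open>n = 1\<close>. The terms with index \<open>-1\<close>
  and \<open>-2\<close> cancel these.\<close>

lemma third_cumulant_closed_form:
  assumes "\<mu> \<noteq> 0"
  shows "mixed_moment \<mu> t 0 a 4 n / (fact n)\<^sup>2 =
    \<mu> ^ (2 * n) * (\<Sum>i\<in>{-2..4::int}. q_coeff a \<mu> t i * of_int (ext_binom (int n + i) i))"
proof -
  define s b where "s = a * t / \<mu>\<^sup>2" and "b = a\<^sup>2 / \<mu>"
  define x where "x = real n"
  let ?g = "\<lambda>p. real (4 choose p) * s ^ p * gauss_poly b (4 - p) (x - real p)"
  have summand: "(if n < p then 0 else real (4 choose p) * (a * t) ^ p *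
      (mixed_moment \<mu> 0 0 a (4 - p) (n - p) / (fact (n - p))\<^sup>2)) =
      \<mu> ^ (2 * n) * (if n < p then 0 else ?g p)" for p
  proof (cases "n < p")
    case False
    then have "\<mu> ^ (2 * n) = \<mu> ^ (2 * (n - p)) * (\<mu>\<^sup>2) ^ p"
      by (simp flip: power_mult power_add add: algebra_simps)
    moreover have "a * t = s * \<mu>\<^sup>2" using assms by (simp add: s_def)
    moreover have "mixed_moment \<mu> 0 0 a (4 - p) (n - p) / (fact (n - p))\<^sup>2 =
        \<mu> ^ (2 * (n - p)) * gauss_poly b (4 - p) (x - real p)"
      using assms False
      by (subst mixed_moment_gauss) (auto simp: gauss_poly_def b_def x_def of_nat_diff power_divide
          field_simps)
    ultimately show ?thesis using False by (simp add: power_mult_distrib)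
  qed simp
  have set: "{-2..4::int} = {-2, -1, 0, 1, 2, 3, 4}" by auto
  have bin: "real_of_int (ext_binom (int n) 0) = 1" "real_of_int (ext_binom (int n + 1) 1) = x + 1"
    "real_of_int (ext_binom (int n + 2) 2) = (x + 1) * (x + 2) / 2"
    "real_of_int (ext_binom (int n + 3) 3) = (x + 1) * (x + 2) * (x + 3) / 6"
    "real_of_int (ext_binom (int n + 4) 4) = (x + 1) * (x + 2) * (x + 3) * (x + 4) / 24"
    using ext_binom_nonneg[of n 0] ext_binom_nonneg[of n 1] ext_binom_nonneg[of n 2]
        ext_binom_nonneg[of n 3] ext_binom_nonneg[of n 4]
    by (simp_all only: of_nat_numeral of_nat_0 of_nat_1 of_int_of_nat_eq choose_poly x_def add_0_right
        binomial_n_0)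
  have "(\<Sum>i\<in>{-2..4::int}. q_coeff a \<mu> t i * of_int (ext_binom (int n + i) i)) =
     s ^ 4 * of_int (ext_binom (int n - 2) (-2)) - 4 * s ^ 3 * (1 + s) *
         of_int (ext_binom (int n - 1) (-1)) + (\<Sum>p\<le>4. ?g p)"
    unfolding gauss_poly_sum
    by (simp add: set bin q_coeff_normalised[OF assms s_def b_def])
  also have "\<dots> = (\<Sum>p\<le>4. if n < p then 0 else ?g p)"
  proof -
    have set': "{..4::nat} = {0, 1, 2, 3, 4}" by auto
    have c: "0 choose 2 = (0::nat)" "1 choose 2 = (0::nat)" "2 choose 2 = (1::nat)" "3 choose 2 =
        (3::nat)" "4 choose 3 = (4 :: nat)" by (simp_all add: numeral_eq_Suc)
    consider "n = 0" | "n = 1" | "n = 2" | "n = 3" | "4 \<le> n" by linarith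
    then show ?thesis
    proof cases
      case 5
      then show ?thesis by (simp add: set' ext_binom_def)
    qed (simp_all add: set' ext_binom_def gauss_poly_def x_def c algebra_simps power_numeral_reduce)
  qed
  finally show ?thesis
    by (simp only: mixed_moment_third_cumulant summand sum_distrib_left)
qed

section \<open>From random variables to the grid\<close>

text \<open>The span of the monomials of degree at most \<open>d\<close> in each of the variables indexed by \<open>A\<close>. On
  this span two product functionals agree as soon as their moments up to order \<open>d\<close> agree.\<close>

inductive cell_poly :: "'c set \<Rightarrow> nat \<Rightarrow> (('c \<Rightarrow> real) \<Rightarrow> real) \<Rightarrow> bool"
  for A :: "'c set" and d :: nat where
  monomial: "(\<And>c. c \<in> A \<Longrightarrow> e c \<le> d) \<Longrightarrow> cell_poly A d (\<lambda>Z. r * (\<Prod>c\<in>A. Z c ^ e c))"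
| add: "cell_poly A d f \<Longrightarrow> cell_poly A d g \<Longrightarrow> cell_poly A d (\<lambda>Z. f Z + g Z)"

lemma cell_poly_sum:
  assumes "finite I" "\<And>i. i \<in> I \<Longrightarrow> cell_poly A d (f i)"
  shows "cell_poly A d (\<lambda>Z. \<Sum>i\<in>I. f i Z)"
  using assms
proof (induction I rule: finite_induct)
  case empty
  show ?case using cell_poly.monomial[of A "\<lambda>_. 0" d 0] by simp
next
  case (insert i I)
  then show ?case using cell_poly.add[of A d "f i"] by simp
qed

lemma cell_poly_mult:
  assumes "cell_poly A d f" "cell_poly A d' g"
  shows "cell_poly A (d + d') (\<lambda>Z. f Z * g Z)"
  using assms(1)
proof (induction rule: cell_poly.induct)
  case (monomial e r)
  show ?case
    using assms(2)
  proof (induction rule: cell_poly.induct)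
    case (monomial e' r')
    have "cell_poly A (d + d') (\<lambda>Z. (r * r') * (\<Prod>c\<in>A. Z c ^ (e c + e' c)))"
      by (rule cell_poly.monomial) (simp add: add_mono monomial \<open>\<And>c. c \<in> A \<Longrightarrow> e c \<le> d\<close>)
    then show ?case by (simp add: power_add prod.distrib mult_ac)
  next
    case (add f g)
    then show ?case using cell_poly.add[OF add.IH] by (simp add: distrib_left)
  qed
next
  case (add f f')
  then show ?case using cell_poly.add[OF add.IH] by (simp add: distrib_right)
qed

lemma cell_poly_fdet: "cell_poly (cells n) 1 (fdet n)"
proof -
  have "cell_poly (cells n) 1 (\<lambda>Z. signof p * (\<Prod>i<n. Z (i, p i)))" if p: "p permutes {..<n}" for p
  proof -
    have "(\<Prod>c\<in>cells n. Z c ^ (if snd c = p (fst c) then 1 else 0)) = (\<Prod>i<n. Z (i, p i))"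
        for Z :: "nat \<times> nat \<Rightarrow> real"
    proof -
      have "(\<Prod>c\<in>cells n. Z c ^ (if snd c = p (fst c) then 1 else 0)) =
          (\<Prod>i<n. \<Prod>j<n. if j = p i then Z (i, j) else 1)"
        unfolding cells_def prod.cartesian_product by (intro prod.cong) auto
      also have "\<dots> = (\<Prod>i<n. Z (i, p i))"
        using permutes_in_image[OF p] by (intro prod.cong) (auto simp: prod.delta)
      finally show ?thesis .
    qed
    then show ?thesis
      using cell_poly.monomial[of "cells n" "\<lambda>c. if snd c = p (fst c) then 1 else 0" 1 "signof p"]
          by simp
  qed
  then have "cell_poly (cells n) 1 (\<lambda>Z. \<Sum>p | p permutes {..<n}. signof p * (\<Prod>i<n. Z (i, p i)))"
    by (intro cell_poly_sum) (simp_all add: finite_permutations)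
  then show ?thesis by (simp only: fdet_permutes[abs_def])
qed

lemma cell_poly_fdet_power4: "cell_poly (cells n) 4 (\<lambda>Z. fdet n Z ^ 4)"
proof -
  have "cell_poly (cells n) (1 + 1) (\<lambda>Z. fdet n Z * fdet n Z)"
    by (intro cell_poly_mult cell_poly_fdet)
  from cell_poly_mult[OF this this]
  have "cell_poly (cells n) ((1 + 1) + (1 + 1)) (\<lambda>Z. fdet n Z ^ 4)"
    by (simp only: power4_eq_xxxx mult.assoc)
  moreover have "(1 + 1) + (1 + 1) = (4 :: nat)" by simp
  ultimately show ?thesis by (simp only:)
qed

lemma cell_poly_expectation:
  fixes X :: "'c \<Rightarrow> 'a \<Rightarrow> real"
  assumes "prob_space M" "finite A" "finite N"
    and indep: "prob_space.indep_vars M (\<lambda>_. borel) X A"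
    and int: "\<And>c r. c \<in> A \<Longrightarrow> r \<le> d \<Longrightarrow> integrable M (\<lambda>\<omega>. X c \<omega> ^ r)"
    and moments: "\<And>c r. c \<in> A \<Longrightarrow> r \<le> d \<Longrightarrow> (\<integral>\<omega>. X c \<omega> ^ r \<partial>M) = (\<Sum>s\<in>N. w s * (s + a) ^ r)"
    and f: "cell_poly A d f"
  shows "integrable M (\<lambda>\<omega>. f (\<lambda>c. X c \<omega>))"
    and "(\<integral>\<omega>. f (\<lambda>c. X c \<omega>) \<partial>M) = grid_mean N w A (\<lambda>Z. f (\<lambda>c. Z c + a)) Z"
proof -
  interpret prob_space M by fact
  have "integrable M (\<lambda>\<omega>. f (\<lambda>c. X c \<omega>)) \<and>
    (\<integral>\<omega>. f (\<lambda>c. X c \<omega>) \<partial>M) = grid_mean N w A (\<lambda>Z. f (\<lambda>c. Z c + a)) Z"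
    using f
  proof (induction rule: cell_poly.induct)
    case (monomial e r)
    have ind: "indep_vars (\<lambda>_. borel) (\<lambda>c \<omega>. X c \<omega> ^ e c) A"
      using indep_vars_compose2[OF indep, of "\<lambda>c x. x ^ e c" "\<lambda>_. borel"] by simp
    have i: "\<And>c. c \<in> A \<Longrightarrow> integrable M (\<lambda>\<omega>. X c \<omega> ^ e c)" using int monomial by blast
    have "(\<integral>\<omega>. (\<Prod>c\<in>A. X c \<omega> ^ e c) \<partial>M) = (\<Prod>c\<in>A. \<Sum>s\<in>N. w s * (s + a) ^ e c)"
      by (subst indep_vars_lebesgue_integral[OF assms(2) ind i])
          (auto intro!: prod.cong moments monomial)
    moreover have "integrable M (\<lambda>\<omega>. \<Prod>c\<in>A. X c \<omega> ^ e c)"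
      by (rule indep_vars_integrable[OF assms(2) ind i])
    ultimately show ?case
      using assms(2,3) by (simp add: grid_mean_cmult grid_mean_prod[where \<phi>="\<lambda>c z. (z + a) ^ e c"])
  next
    case (add f g)
    then show ?case by (simp add: grid_mean_add)
  qed
  then show "integrable M (\<lambda>\<omega>. f (\<lambda>c. X c \<omega>))"
    and "(\<integral>\<omega>. f (\<lambda>c. X c \<omega>) \<partial>M) = grid_mean N w A (\<lambda>Z. f (\<lambda>c. Z c + a)) Z" by auto
qed

lemma grid_weight_shifted_moments:
  assumes "p\<^sub>2 = m 2 - m 1 ^ 2"
    and "p\<^sub>3 = m 3 - 3 * m 1 * m 2 + 2 * m 1 ^ 3"
    and "p\<^sub>4 = m 4 - 4 * m 1 * m 3 + 6 * m 1 ^ 2 * m 2 - 3 * m 1 ^ 4"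
    and "m 0 = (1 :: real)" "r \<le> 4"
  shows "(\<Sum>s\<in>grid. grid_weight p\<^sub>2 p\<^sub>3 p\<^sub>4 s * (s + m (1 :: nat)) ^ r) = m r"
proof -
  let ?a = "m 1"
  have pw: "(s + ?a) ^ 2 = ?a\<^sup>2 + (2 * ?a) * s + 1 * s\<^sup>2 + 0 * s ^ 3 + 0 * s ^ 4"
    "(s + ?a) ^ 3 = ?a ^ 3 + (3 * ?a\<^sup>2) * s + (3 * ?a) * s\<^sup>2 + 1 * s ^ 3 + 0 * s ^ 4"
    "(s + ?a) ^ 4 = ?a ^ 4 + (4 * ?a ^ 3) * s + (6 * ?a\<^sup>2) * s\<^sup>2 + (4 * ?a) * s ^ 3 + 1 * s ^ 4" for s
    by (simp_all add: algebra_simps power2_eq_square power3_eq_cube power4_eq_xxxx)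
  consider "r = 0" | "r = 1" | "r = 2" | "r = 3" | "r = 4" using assms(5) by linarith
  then show ?thesis
  proof cases
    case 1
    then show ?thesis using assms(4) by (simp add: grid_weight_moments)
  next
    case 2
    then show ?thesis
        by (simp add: distrib_left sum.distrib grid_weight_moments flip: sum_distrib_right)
  qed (simp_all only: pw grid_weight_quartic, simp_all add: assms(1-3) algebra_simps power2_eq_square
      power3_eq_cube power4_eq_xxxx)
qed

theorem corollary1p1:
  fixes M :: "'a measure"
    and X :: "nat \<Rightarrow> nat \<Rightarrow> 'a \<Rightarrow> real"
    and m :: "nat \<Rightarrow> real"
    and \<mu>\<^sub>2 \<mu>\<^sub>3 \<mu>\<^sub>4 :: real
    and f\<^sub>4 :: "nat \<Rightarrow> real"
    and n :: nat
  assumes "prob_space M"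
    and indep: "prob_space.indep_vars M (\<lambda>_. borel) (\<lambda>(i, j). X i j) UNIV"
    and ident: "\<And>i j k l. distr M borel (X i j) = distr M borel (X k l)"
    and finite_moments: "\<And>i j r. r \<le> 4 \<Longrightarrow> integrable M (\<lambda>\<omega>. X i j \<omega> ^ r)"
    and m: "\<And>i j r. r \<le> 4 \<Longrightarrow> m r = (\<integral>\<omega>. X i j \<omega> ^ r \<partial>M)"
    and \<mu>2: "\<mu>\<^sub>2 = m 2 - m 1 ^ 2"
    and \<mu>3: "\<mu>\<^sub>3 = m 3 - 3 * m 1 * m 2 + 2 * m 1 ^ 3"
    and \<mu>4: "\<mu>\<^sub>4 = m 4 - 4 * m 1 * m 3 + 6 * m 1 ^ 2 * m 2 - 3 * m 1 ^ 4"
    and "\<mu>\<^sub>2 \<noteq> 0"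
    and f4: "\<And>k. f\<^sub>4 k = (\<integral>\<omega>. Determinant.det (Matrix.mat k k (\<lambda>(i, j). X i j \<omega>)) ^ 4 \<partial>M)"
  shows "f\<^sub>4 n =
    (fact n) ^ 2 * \<mu>\<^sub>2 ^ (2 * n) *
      (\<Sum>j=0..n. 1 / fact j * (\<mu>\<^sub>4 / \<mu>\<^sub>2 ^ 2 - 3) ^ j *
        (\<Sum>i\<in>{-2..4::int}. q_coeff (m 1) \<mu>\<^sub>2 \<mu>\<^sub>3 i *
           of_int (ext_binom (int n - int j + i) i)))"
proof -
  interpret prob_space M by fact
  define \<kappa>\<^sub>4 where "\<kappa>\<^sub>4 = \<mu>\<^sub>4 - 3 * \<mu>\<^sub>2\<^sup>2"
  let ?Q = "\<lambda>k. \<Sum>i\<in>{-2..4::int}. q_coeff (m 1) \<mu>\<^sub>2 \<mu>\<^sub>3 i * of_int (ext_binom (int k + i) i)"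
  have "m 0 = 1" using m[of 0 0 0] by (simp add: prob_space)
  have "f\<^sub>4 n = (\<integral>\<omega>. fdet n (\<lambda>c. (case c of (i, j) \<Rightarrow> X i j) \<omega>) ^ 4 \<partial>M)"
    by (simp add: f4 fdet_def case_prod_beta')
  also have "\<dots> = mixed_moment \<mu>\<^sub>2 \<mu>\<^sub>3 \<kappa>\<^sub>4 (m 1) 4 n"
  proof -
    have "(\<integral>\<omega>. fdet n (\<lambda>c. (case c of (i, j) \<Rightarrow> X i j) \<omega>) ^ 4 \<partial>M) =
      grid_mean grid (grid_weight \<mu>\<^sub>2 \<mu>\<^sub>3 \<mu>\<^sub>4) (cells n) (\<lambda>Z. fdet n (\<lambda>c. Z c + m 1) ^ 4) (\<lambda>_. 0)"
    proof (rule cell_poly_expectation(2)[OF assms(1) finite_cells finite_grid _ _ _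
        cell_poly_fdet_power4])
      show "indep_vars (\<lambda>_. borel) (\<lambda>(i, j). X i j) (cells n)"
        by (rule indep_vars_subset[OF indep]) simp
    next
      fix c :: "nat \<times> nat" and r :: nat assume r: "r \<le> 4"
      show "integrable M (\<lambda>\<omega>. (case c of (i, j) \<Rightarrow> X i j) \<omega> ^ r)"
        using finite_moments[OF r] by (cases c) simp
      show "(\<integral>\<omega>. (case c of (i, j) \<Rightarrow> X i j) \<omega> ^ r \<partial>M) =
          (\<Sum>s\<in>grid. grid_weight \<mu>\<^sub>2 \<mu>\<^sub>3 \<mu>\<^sub>4 s * (s + m 1) ^ r)"
        unfolding grid_weight_shifted_moments[OF \<mu>2 \<mu>3 \<mu>4 \<open>m 0 = 1\<close> r] using m[OF r] by (cases c) simp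
    qed
    then show ?thesis by (simp add: mixed_moment_def \<kappa>\<^sub>4_def)
  qed
  also have "\<dots> = (fact n)\<^sup>2 * (mixed_moment \<mu>\<^sub>2 \<mu>\<^sub>3 \<kappa>\<^sub>4 (m 1) 4 n / (fact n)\<^sup>2)" by simp
  also have "\<dots> = (fact n)\<^sup>2 * (\<Sum>j\<le>n. \<kappa>\<^sub>4 ^ j / fact j * (\<mu>\<^sub>2 ^ (2 * (n - j)) * ?Q (n - j)))"
    by (simp only: mixed_moment_fourth_cumulant[of \<mu>\<^sub>2 \<mu>\<^sub>3 \<kappa>\<^sub>4 "m 1" n]
        third_cumulant_closed_form[OF \<open>\<mu>\<^sub>2 \<noteq> 0\<close>])
  also have "(\<Sum>j\<le>n. \<kappa>\<^sub>4 ^ j / fact j * (\<mu>\<^sub>2 ^ (2 * (n - j)) * ?Q (n - j))) =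
      (\<Sum>j=0..n. \<mu>\<^sub>2 ^ (2 * n) * (1 / fact j * (\<mu>\<^sub>4 / \<mu>\<^sub>2 ^ 2 - 3) ^ j * ?Q (n - j)))"
  proof (rule sum.cong)
    fix j assume "j \<in> {0..n}"
    then have "\<mu>\<^sub>2 ^ (2 * n) = \<mu>\<^sub>2 ^ (2 * (n - j)) * (\<mu>\<^sub>2\<^sup>2) ^ j"
      by (simp flip: power_mult power_add add: algebra_simps)
    moreover have "\<kappa>\<^sub>4 = (\<mu>\<^sub>4 / \<mu>\<^sub>2 ^ 2 - 3) * \<mu>\<^sub>2\<^sup>2"
      using \<open>\<mu>\<^sub>2 \<noteq> 0\<close> by (simp add: \<kappa>\<^sub>4_def field_simps)
    ultimately show "\<kappa>\<^sub>4 ^ j / fact j * (\<mu>\<^sub>2 ^ (2 * (n - j)) * ?Q (n - j)) =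
        \<mu>\<^sub>2 ^ (2 * n) * (1 / fact j * (\<mu>\<^sub>4 / \<mu>\<^sub>2 ^ 2 - 3) ^ j * ?Q (n - j))"
      by (simp only: power_mult_distrib) simp
  qed auto
  also have "(fact n)\<^sup>2 * \<dots> =
      (fact n)\<^sup>2 * \<mu>\<^sub>2 ^ (2 * n) * (\<Sum>j=0..n. 1 / fact j * (\<mu>\<^sub>4 / \<mu>\<^sub>2 ^ 2 - 3) ^ j * ?Q (n - j))"
    by (simp only: sum_distrib_left mult.assoc)
  finally show ?thesis
    by (simp add: of_nat_diff)
qed

end
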